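(* Let $p > 3$ be a prime. Then the following statements are equivalent. (1) The prime $p$ is a Mersenne prime. (2) There is a non-trivial abelian group $G$ and a field $k$ such that every non-trivial unit in the group algebra $kG$ has order $p$. (3) There is a non-trivial group $G$ and a field $k$ such that every non-trivial unit in the group algebra $kG$ has order $p$. (4) Every non-trivial unit in $\mathbb{F}_2 C_p$ has order $p$. (5) $(1+x+x^2)^p = 1$ in $\mathbb{F}_2 C_p$, where $x$ is a generator of $C_p$. (6) $(1+x)^p = (1+x^3)^p$ in $\mathbb{F}_2 C_p$, where $x$ is a generator of $C_p$. (7) $\binom{p}{r} \equiv \binom{p}{3r \bmod p} \pmod 2$ for all $1 \le r \le p-1$. (8) The group of $p \times p$ invertible circulant matrices over $\mathbb{F}_2$ is an elementary abelian $p$-group. (9) The circulant matrix $\mathrm{circ}(1,1,1,0,0,\dots,0)$ is of order $p$ in the ring of $p \times p$ matrices over $\mathbb{F}_2$. (10) $[\mathrm{circ}(1,1,0,0,\dots,0)]^p = [\mathrm{circ}(1,0,0,1,0,\dots,0)]^p$ in the ring of $p \times p$ matrices over $\mathbb{F}_2$. (11) Every circulant $(p,p)$ bipartite graph with an odd number of perfect matchings has $s_{ij}(p) \bmod 2 = \delta_{ij}$ for all $1\le i,j\le p$. (12) The $(p,p)$ bipartite graph corresponding to the $p \times p$ circulant matrix $\mathrm{circ}(1,1,1,0,0,\dots,0)$ has $s_{ij}(p) \bmod 2 = \delta_{ij}$ for all $1\le i,j\le p$.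
   Context: A Mersenne prime is a prime of the form $2^n-1$ for some positive integer $n$. $C_p$ is the multiplicative cyclic group of order $p$; $kG$ is the group algebra of $G$ over $k$. A non-trivial unit is a unit different from the identity $1$; the order of a unit (or invertible matrix) is its multiplicative order. For an integer $m$, $m \bmod p$ denotes the residue in $\{0,\dots,p-1\}$. An $n\times n$ matrix over a field is circulant if each column is obtained from the preceding column by rotating it cyclically one entry down; $\mathrm{circ}(\mathbf v)$ denotes the circulant matrix with first column $\mathbf v$. Here the circulant matrices are of size $p\times p$, and $\mathrm{circ}(1,0,0,1,0,\dots,0)$ has $1$'s in the first and fourth entries of its first column. An $(n,n)$ bipartite graph is a bipartite graph on labeled vertex sets $A=\{a_1,\dots,a_n\}$ and $B=\{b_1,\dots,b_n\}$. Its biadjacency matrix is the $n\times n$ binary matrix $M=(m_{ij})$ with $m_{ij}=1$ if and only if $a_i$ is adjacent to $b_j$; this gives a bijection between such graphs and $n\times n$ binary matrices, and one speaks of the graph corresponding to a binary matrix. The graph is circulant if its biadjacency matrix is circulant. A perfect matching is a set of edges such that every vertex is incident to exactly one of them. A pseudopath of length $r$ is an ordered sequence $e_1,\dots,e_r$ of edges (repetitions allowed), each regarded as going from its endpoint in $A$ (head) to its endpoint in $B$ (tail), such that for all $1\le i\le r-1$ the endpoint of $e_i$ in $B$ and the endpoint of $e_{i+1}$ in $A$ have the same subscript. It is between $a_i$ and $b_j$ if $e_1$ starts at $a_i$ and $e_r$ ends at $b_j$. $s_{ij}(r)$ is the number of pseudopaths of length $r$ between $a_i$ and $b_j$ (equivalently,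 the $(i,j)$ entry of the integer matrix $M^r$). $\delta_{ij}$ is the Kronecker delta. *)

theory Defs
  imports
    "HOL-Algebra.Elementary_Groups"
    "HOL-Algebra.Multiplicative_Group"
    "HOL-Number_Theory.Cong"
    "HOL-Library.Z2"
    "HOL-Library.Infinite_Typeclass"
    "Jordan_Normal_Form.Matrix"
begin

definition all_equivalent :: "bool list \<Rightarrow> bool" where
  "all_equivalent Ps \<longleftrightarrow> (\<forall>P \<in> set Ps. \<forall>Q \<in> set Ps. P \<longleftrightarrow> Q)"

definition mersenne_prime :: "nat \<Rightarrow> bool" where
  "mersenne_prime p \<longleftrightarrow> prime p \<and> (\<exists>n::nat. n > 0 \<and> p = 2 ^ n - 1)"


subsection \<open>Group algebras\<close>

definition F2 :: "bit ring" where
  "F2 = \<lparr>carrier = UNIV, monoid.mult = (*), one = 1, zero = 0, add = (+)\<rparr>"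

definition supp :: "('k, 'm) ring_scheme \<Rightarrow> ('g, 'n) monoid_scheme \<Rightarrow> ('g \<Rightarrow> 'k) \<Rightarrow> 'g set" where
  "supp k G f = {g \<in> carrier G. f g \<noteq> \<zero>\<^bsub>k\<^esub>}"

text \<open>
  The formal sum of the \<open>f g \<cdot> g\<close> is the finitely supported function \<open>f\<close>, extended by zero
  outside the carrier of the group so that equality of elements is equality of functions.
\<close>

definition group_algebra ::
  "('k, 'm) ring_scheme \<Rightarrow> ('g, 'n) monoid_scheme \<Rightarrow> ('g \<Rightarrow> 'k) ring" where
  "group_algebra k G =
    \<lparr>carrier = {f. (\<forall>g. f g \<in> carrier k) \<and> (\<forall>g. g \<notin> carrier G \<longrightarrow> f g = \<zero>\<^bsub>k\<^esub>) \<and> finite (supp k G f)},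
     monoid.mult = (\<lambda>f h g. if g \<in> carrier G
               then \<Oplus>\<^bsub>k\<^esub>a \<in> supp k G f. f a \<otimes>\<^bsub>k\<^esub> h (inv\<^bsub>G\<^esub> a \<otimes>\<^bsub>G\<^esub> g) else \<zero>\<^bsub>k\<^esub>),
     one = (\<lambda>g. if g = \<one>\<^bsub>G\<^esub> then \<one>\<^bsub>k\<^esub> else \<zero>\<^bsub>k\<^esub>),
     zero = (\<lambda>g. \<zero>\<^bsub>k\<^esub>),
     add = (\<lambda>f h g. f g \<oplus>\<^bsub>k\<^esub> h g)\<rparr>"

definition group_elem :: "('k, 'm) ring_scheme \<Rightarrow> 'g \<Rightarrow> 'g \<Rightarrow> 'k" where
  "group_elem k x = (\<lambda>g. if g = x then \<one>\<^bsub>k\<^esub> else \<zero>\<^bsub>k\<^esub>)"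

text \<open>
  HOL cannot quantify existentially over types. ``There are a group and a field such that \<dots>'' is
  therefore stated as existence of structures with carriers inside the types \<open>'g\<close> and \<open>'k\<close>,
  where \<open>'g\<close> and \<open>'k\<close> are type variables of class \<^class>\<open>infinite\<close>. Infinite types contain
  copies of all finite structures; and since \<open>'g\<close> and \<open>'k\<close> are arbitrary, conclusions drawn from
  such an existence statement hold for groups and fields of every cardinality.
\<close>

definition nontrivial_units_have_order :: "('a, 'm) ring_scheme \<Rightarrow> nat \<Rightarrow> bool" where
  "nontrivial_units_have_order R n \<longleftrightarrow>
    (\<forall>u \<in> Units R. u \<noteq> \<one>\<^bsub>R\<^esub> \<longrightarrow> group.ord (units_of R) u = n)"

definition elementary_abelian :: "nat \<Rightarrow> ('a, 'm) monoid_scheme \<Rightarrow> bool" where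
  "elementary_abelian p G \<longleftrightarrow>
    prime p \<and> comm_group G \<and> (\<forall>x \<in> carrier G. x \<noteq> \<one>\<^bsub>G\<^esub> \<longrightarrow> group.ord G x = p)"


subsection \<open>Circulant matrices\<close>

definition rotate_down :: "'a vec \<Rightarrow> 'a vec" where
  "rotate_down v = vec (dim_vec v) (\<lambda>i. v $ (if i = 0 then dim_vec v - 1 else i - 1))"

definition circulant :: "'a mat \<Rightarrow> bool" where
  "circulant A \<longleftrightarrow> square_mat A \<and>
    (\<forall>j. Suc j < dim_col A \<longrightarrow> col A (Suc j) = rotate_down (col A j))"

definition circ :: "'a vec \<Rightarrow> 'a mat" where
  "circ v = mat_of_cols (dim_vec v) (map (\<lambda>j. (rotate_down ^^ j) v) [0..<dim_vec v])"

definition circulant_unit_group :: "'a::semiring_1 itself \<Rightarrow> nat \<Rightarrow> 'a mat monoid" where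
  "circulant_unit_group ty n =
    (units_of (ring_mat ty n ()))\<lparr>carrier := {A \<in> Units (ring_mat ty n ()). circulant A}\<rparr>"


subsection \<open>Bipartite graphs\<close>

text \<open>
  An \<open>(n,n)\<close> bipartite graph on \<open>a\<^sub>0, \<dots>, a\<^sub>n\<^sub>-\<^sub>1\<close> and \<open>b\<^sub>0, \<dots>, b\<^sub>n\<^sub>-\<^sub>1\<close> is given by its set of
  edges, where the pair \<open>(i, j)\<close> stands for the edge joining \<open>a\<^sub>i\<close> and \<open>b\<^sub>j\<close>. Subscripts start
  at 0, as matrix indices do.
\<close>

definition bipartite_graph :: "nat \<Rightarrow> (nat \<times> nat) set \<Rightarrow> bool" where
  "bipartite_graph n E \<longleftrightarrow> E \<subseteq> {..<n} \<times> {..<n}"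

definition biadjacency :: "nat \<Rightarrow> (nat \<times> nat) set \<Rightarrow> int mat" where
  "biadjacency n E = mat n n (\<lambda>(i, j). if (i, j) \<in> E then 1 else 0)"

definition graph_of_mat :: "int mat \<Rightarrow> (nat \<times> nat) set" where
  "graph_of_mat M = {(i, j). i < dim_row M \<and> j < dim_col M \<and> M $$ (i, j) = 1}"

definition perfect_matching :: "nat \<Rightarrow> (nat \<times> nat) set \<Rightarrow> (nat \<times> nat) set \<Rightarrow> bool" where
  "perfect_matching n E M \<longleftrightarrow> M \<subseteq> E \<and>
    (\<forall>i<n. \<exists>!e. e \<in> M \<and> fst e = i) \<and> (\<forall>j<n. \<exists>!e. e \<in> M \<and> snd e = j)"

definition pseudopath :: "(nat \<times> nat) set \<Rightarrow> nat \<Rightarrow> nat \<Rightarrow> (nat \<times> nat) list \<Rightarrow> bool" where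
  "pseudopath E i j es \<longleftrightarrow> es \<noteq> [] \<and> set es \<subseteq> E \<and>
    (\<forall>l. Suc l < length es \<longrightarrow> snd (es ! l) = fst (es ! Suc l)) \<and>
    fst (hd es) = i \<and> snd (last es) = j"

definition num_pseudopaths :: "(nat \<times> nat) set \<Rightarrow> nat \<Rightarrow> nat \<Rightarrow> nat \<Rightarrow> nat" where
  "num_pseudopaths E r i j = card {es. length es = r \<and> pseudopath E i j es}"


subsection \<open>Adequacy of the definitions\<close>

text \<open>
  The group algebra over a field is a ring into whose units the group embeds, \<open>circ v\<close> is the
  circulant matrix with first column \<open>v\<close>, and pseudopaths are counted by the powers of the
  biadjacency matrix.
\<close>

lemma field_F2: "field F2"
proof (rule cring.cring_fieldI2)
  show "cring F2"
  proof (rule cringI)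
    show "abelian_group F2"
      by (rule abelian_groupI) (auto simp: F2_def algebra_simps intro: exI[of _ "- x" for x :: bit])
    show "comm_monoid F2"
      by (rule comm_monoidI) (auto simp: F2_def algebra_simps)
  qed (auto simp: F2_def algebra_simps)
qed (auto simp: F2_def)

context
  fixes k :: "('k, 'm) ring_scheme" and G :: "('g, 'n) monoid_scheme"
  assumes k: "cring k" and G: "group G"
begin

interpretation k: cring k by (rule k)
interpretation G: group G by (rule G)

lemma ga_carrier: "f \<in> carrier (group_algebra k G) \<longleftrightarrow>
    (\<forall>g. f g \<in> carrier k) \<and> (\<forall>g. g \<notin> carrier G \<longrightarrow> f g = \<zero>\<^bsub>k\<^esub>) \<and> finite (supp k G f)"
  by (simp add: group_algebra_def)

lemma ga_closed: "f \<in> carrier (group_algebra k G) \<Longrightarrow> f g \<in> carrier k"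
  by (simp add: ga_carrier)

lemma ga_mult_superset:
  assumes "f \<in> carrier (group_algebra k G)" "h \<in> carrier (group_algebra k G)" "finite S" "supp k G f \<subseteq> S" "S \<subseteq> carrier G"
    "g \<in> carrier G"
  shows "(f \<otimes>\<^bsub>group_algebra k G\<^esub> h) g = (\<Oplus>\<^bsub>k\<^esub>a \<in> S. f a \<otimes>\<^bsub>k\<^esub> h (inv\<^bsub>G\<^esub> a \<otimes>\<^bsub>G\<^esub> g))"
proof -
  have "(\<Oplus>\<^bsub>k\<^esub>a \<in> supp k G f. f a \<otimes>\<^bsub>k\<^esub> h (inv\<^bsub>G\<^esub> a \<otimes>\<^bsub>G\<^esub> g)) =
        (\<Oplus>\<^bsub>k\<^esub>a \<in> S. f a \<otimes>\<^bsub>k\<^esub> h (inv\<^bsub>G\<^esub> a \<otimes>\<^bsub>G\<^esub> g))"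
    by (rule k.add.finprod_mono_neutral_cong_left)
       (use assms in \<open>auto simp: supp_def ga_closed\<close>)
  then show ?thesis using assms(6) by (simp add: group_algebra_def)
qed

lemma ga_supp_mult:
  assumes "f \<in> carrier (group_algebra k G)" "h \<in> carrier (group_algebra k G)"
  shows "supp k G (f \<otimes>\<^bsub>group_algebra k G\<^esub> h) \<subseteq> (\<lambda>(a, b). a \<otimes>\<^bsub>G\<^esub> b) ` (supp k G f \<times> supp k G h)"
proof
  fix g assume g: "g \<in> supp k G (f \<otimes>\<^bsub>group_algebra k G\<^esub> h)"
  then have gG: "g \<in> carrier G" and ne: "(f \<otimes>\<^bsub>group_algebra k G\<^esub> h) g \<noteq> \<zero>\<^bsub>k\<^esub>" by (auto simp: supp_def)
  have "\<exists>a \<in> supp k G f. f a \<otimes>\<^bsub>k\<^esub> h (inv\<^bsub>G\<^esub> a \<otimes>\<^bsub>G\<^esub> g) \<noteq> \<zero>\<^bsub>k\<^esub>"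
  proof (rule ccontr)
    assume "\<not> ?thesis"
    then have "(\<Oplus>\<^bsub>k\<^esub>a \<in> supp k G f. f a \<otimes>\<^bsub>k\<^esub> h (inv\<^bsub>G\<^esub> a \<otimes>\<^bsub>G\<^esub> g)) = \<zero>\<^bsub>k\<^esub>"
      by (intro k.add.finprod_one_eqI) auto
    then show False using ne gG by (simp add: group_algebra_def)
  qed
  then obtain a where a: "a \<in> supp k G f" "f a \<otimes>\<^bsub>k\<^esub> h (inv\<^bsub>G\<^esub> a \<otimes>\<^bsub>G\<^esub> g) \<noteq> \<zero>\<^bsub>k\<^esub>" by blast
  then have aG: "a \<in> carrier G" by (simp add: supp_def)
  have "h (inv\<^bsub>G\<^esub> a \<otimes>\<^bsub>G\<^esub> g) \<noteq> \<zero>\<^bsub>k\<^esub>"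
    using a ga_closed[OF assms(1)] by auto
  then have "inv\<^bsub>G\<^esub> a \<otimes>\<^bsub>G\<^esub> g \<in> supp k G h" using aG gG by (simp add: supp_def)
  moreover have "g = a \<otimes>\<^bsub>G\<^esub> (inv\<^bsub>G\<^esub> a \<otimes>\<^bsub>G\<^esub> g)"
    using aG gG by (simp add: G.m_assoc[symmetric])
  ultimately show "g \<in> (\<lambda>(a, b). a \<otimes>\<^bsub>G\<^esub> b) ` (supp k G f \<times> supp k G h)"
    using a(1) by (intro image_eqI[of _ _ "(a, inv\<^bsub>G\<^esub> a \<otimes>\<^bsub>G\<^esub> g)"]) auto
qed

lemma ga_mult_closed:
  assumes "f \<in> carrier (group_algebra k G)" "h \<in> carrier (group_algebra k G)"
  shows "f \<otimes>\<^bsub>group_algebra k G\<^esub> h \<in> carrier (group_algebra k G)"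
proof -
  have "finite (supp k G (f \<otimes>\<^bsub>group_algebra k G\<^esub> h))"
    by (rule finite_subset[OF ga_supp_mult[OF assms]]) (use assms in \<open>auto simp: ga_carrier\<close>)
  moreover have "(f \<otimes>\<^bsub>group_algebra k G\<^esub> h) g \<in> carrier k" for g
    using assms by (auto simp: group_algebra_def intro!: k.finsum_closed)
  moreover have "g \<notin> carrier G \<Longrightarrow> (f \<otimes>\<^bsub>group_algebra k G\<^esub> h) g = \<zero>\<^bsub>k\<^esub>" for g
    by (simp add: group_algebra_def)
  ultimately show ?thesis by (simp add: ga_carrier)
qed

lemma ga_mult_assoc:
  assumes f: "f \<in> carrier (group_algebra k G)" and h: "h \<in> carrier (group_algebra k G)" and l: "l \<in> carrier (group_algebra k G)"
  shows "(f \<otimes>\<^bsub>group_algebra k G\<^esub> h) \<otimes>\<^bsub>group_algebra k G\<^esub> l = f \<otimes>\<^bsub>group_algebra k G\<^esub> (h \<otimes>\<^bsub>group_algebra k G\<^esub> l)"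
proof
  fix g
  show "((f \<otimes>\<^bsub>group_algebra k G\<^esub> h) \<otimes>\<^bsub>group_algebra k G\<^esub> l) g = (f \<otimes>\<^bsub>group_algebra k G\<^esub> (h \<otimes>\<^bsub>group_algebra k G\<^esub> l)) g"
  proof (cases "g \<in> carrier G")
    case False then show ?thesis by (simp add: group_algebra_def)
  next
    case g: True
    let ?F = "supp k G f" and ?H = "supp k G h"
    let ?S = "(\<lambda>(a, b). a \<otimes>\<^bsub>G\<^esub> b) ` (?F \<times> ?H)"
    have fin: "finite ?F" "finite ?H" "finite ?S" using f h by (auto simp: ga_carrier)
    have sub: "?F \<subseteq> carrier G" "?H \<subseteq> carrier G" by (auto simp: supp_def)
    then have subS: "?S \<subseteq> carrier G" by auto
    note cl = ga_closed[OF f] ga_closed[OF h] ga_closed[OF l]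
    have "((f \<otimes>\<^bsub>group_algebra k G\<^esub> h) \<otimes>\<^bsub>group_algebra k G\<^esub> l) g =
        (\<Oplus>\<^bsub>k\<^esub>c \<in> ?S. (f \<otimes>\<^bsub>group_algebra k G\<^esub> h) c \<otimes>\<^bsub>k\<^esub> l (inv\<^bsub>G\<^esub> c \<otimes>\<^bsub>G\<^esub> g))"
      by (rule ga_mult_superset[OF ga_mult_closed[OF f h] l fin(3) ga_supp_mult[OF f h] subS g])
    also have "\<dots> = (\<Oplus>\<^bsub>k\<^esub>c \<in> ?S. \<Oplus>\<^bsub>k\<^esub>a \<in> ?F. f a \<otimes>\<^bsub>k\<^esub> h (inv\<^bsub>G\<^esub> a \<otimes>\<^bsub>G\<^esub> c) \<otimes>\<^bsub>k\<^esub> l (inv\<^bsub>G\<^esub> c \<otimes>\<^bsub>G\<^esub> g))"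
    proof (rule k.finsum_cong')
      fix c assume "c \<in> ?S"
      then have "c \<in> carrier G" using subS by blast
      then show "(f \<otimes>\<^bsub>group_algebra k G\<^esub> h) c \<otimes>\<^bsub>k\<^esub> l (inv\<^bsub>G\<^esub> c \<otimes>\<^bsub>G\<^esub> g) =
          (\<Oplus>\<^bsub>k\<^esub>a \<in> ?F. f a \<otimes>\<^bsub>k\<^esub> h (inv\<^bsub>G\<^esub> a \<otimes>\<^bsub>G\<^esub> c) \<otimes>\<^bsub>k\<^esub> l (inv\<^bsub>G\<^esub> c \<otimes>\<^bsub>G\<^esub> g))"
        using fin cl ga_mult_superset[OF f h fin(1) _ sub(1)]
        by (simp add: k.finsum_ldistr)
    qed (use cl in \<open>auto intro!: k.finsum_closed\<close>)
    also have "\<dots> = (\<Oplus>\<^bsub>k\<^esub>a \<in> ?F. \<Oplus>\<^bsub>k\<^esub>c \<in> ?S. f a \<otimes>\<^bsub>k\<^esub> h (inv\<^bsub>G\<^esub> a \<otimes>\<^bsub>G\<^esub> c) \<otimes>\<^bsub>k\<^esub> l (inv\<^bsub>G\<^esub> c \<otimes>\<^bsub>G\<^esub> g))"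
      by (rule k.add.finprod_finprod_swap) (use fin cl in auto)
    also have "\<dots> = (\<Oplus>\<^bsub>k\<^esub>a \<in> ?F. f a \<otimes>\<^bsub>k\<^esub> (h \<otimes>\<^bsub>group_algebra k G\<^esub> l) (inv\<^bsub>G\<^esub> a \<otimes>\<^bsub>G\<^esub> g))"
    proof (rule k.finsum_cong')
      fix a assume a: "a \<in> ?F"
      then have aG: "a \<in> carrier G" using sub by blast
      let ?T = "(\<lambda>c. inv\<^bsub>G\<^esub> a \<otimes>\<^bsub>G\<^esub> c) ` ?S"
      have inj: "inj_on (\<lambda>c. inv\<^bsub>G\<^esub> a \<otimes>\<^bsub>G\<^esub> c) ?S"
      proof (rule inj_onI)
        fix c d assume cd: "c \<in> ?S" "d \<in> ?S" and e: "inv\<^bsub>G\<^esub> a \<otimes>\<^bsub>G\<^esub> c = inv\<^bsub>G\<^esub> a \<otimes>\<^bsub>G\<^esub> d"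
        have "c \<in> carrier G" "d \<in> carrier G" using cd subS by blast+
        then show "c = d" using e aG by simp
      qed
      have T: "?T \<subseteq> carrier G" using aG subS by auto
      have HT: "?H \<subseteq> ?T"
      proof
        fix b assume b: "b \<in> ?H"
        then have "b \<in> carrier G" using sub by blast
        then have "b = inv\<^bsub>G\<^esub> a \<otimes>\<^bsub>G\<^esub> (a \<otimes>\<^bsub>G\<^esub> b)" using aG by (simp add: G.m_assoc[symmetric])
        moreover have "a \<otimes>\<^bsub>G\<^esub> b \<in> ?S" using a b by auto
        ultimately show "b \<in> ?T" by blast
      qed
      have "(h \<otimes>\<^bsub>group_algebra k G\<^esub> l) (inv\<^bsub>G\<^esub> a \<otimes>\<^bsub>G\<^esub> g) =
          (\<Oplus>\<^bsub>k\<^esub>b \<in> ?T. h b \<otimes>\<^bsub>k\<^esub> l (inv\<^bsub>G\<^esub> b \<otimes>\<^bsub>G\<^esub> (inv\<^bsub>G\<^esub> a \<otimes>\<^bsub>G\<^esub> g)))"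
        by (rule ga_mult_superset[OF h l _ HT T]) (use fin aG g in auto)
      also have "\<dots> = (\<Oplus>\<^bsub>k\<^esub>c \<in> ?S. h (inv\<^bsub>G\<^esub> a \<otimes>\<^bsub>G\<^esub> c) \<otimes>\<^bsub>k\<^esub>
          l (inv\<^bsub>G\<^esub> (inv\<^bsub>G\<^esub> a \<otimes>\<^bsub>G\<^esub> c) \<otimes>\<^bsub>G\<^esub> (inv\<^bsub>G\<^esub> a \<otimes>\<^bsub>G\<^esub> g)))"
        by (rule k.finsum_reindex[OF _ inj]) (use cl in auto)
      also have "\<dots> = (\<Oplus>\<^bsub>k\<^esub>c \<in> ?S. h (inv\<^bsub>G\<^esub> a \<otimes>\<^bsub>G\<^esub> c) \<otimes>\<^bsub>k\<^esub> l (inv\<^bsub>G\<^esub> c \<otimes>\<^bsub>G\<^esub> g))"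
      proof (rule k.finsum_cong')
        fix c assume "c \<in> ?S"
        then have c: "c \<in> carrier G" using subS by blast
        have "inv\<^bsub>G\<^esub> (inv\<^bsub>G\<^esub> a \<otimes>\<^bsub>G\<^esub> c) \<otimes>\<^bsub>G\<^esub> (inv\<^bsub>G\<^esub> a \<otimes>\<^bsub>G\<^esub> g) = inv\<^bsub>G\<^esub> c \<otimes>\<^bsub>G\<^esub> (a \<otimes>\<^bsub>G\<^esub> (inv\<^bsub>G\<^esub> a \<otimes>\<^bsub>G\<^esub> g))"
          using aG g c by (simp add: G.inv_mult_group G.m_assoc)
        also have "a \<otimes>\<^bsub>G\<^esub> (inv\<^bsub>G\<^esub> a \<otimes>\<^bsub>G\<^esub> g) = g"
          using aG g by (simp add: G.m_assoc[symmetric])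
        finally show "h (inv\<^bsub>G\<^esub> a \<otimes>\<^bsub>G\<^esub> c) \<otimes>\<^bsub>k\<^esub>
          l (inv\<^bsub>G\<^esub> (inv\<^bsub>G\<^esub> a \<otimes>\<^bsub>G\<^esub> c) \<otimes>\<^bsub>G\<^esub> (inv\<^bsub>G\<^esub> a \<otimes>\<^bsub>G\<^esub> g)) =
          h (inv\<^bsub>G\<^esub> a \<otimes>\<^bsub>G\<^esub> c) \<otimes>\<^bsub>k\<^esub> l (inv\<^bsub>G\<^esub> c \<otimes>\<^bsub>G\<^esub> g)" by simp
      qed (use cl in auto)
      finally show "(\<Oplus>\<^bsub>k\<^esub>c \<in> ?S. f a \<otimes>\<^bsub>k\<^esub> h (inv\<^bsub>G\<^esub> a \<otimes>\<^bsub>G\<^esub> c) \<otimes>\<^bsub>k\<^esub> l (inv\<^bsub>G\<^esub> c \<otimes>\<^bsub>G\<^esub> g)) =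
          f a \<otimes>\<^bsub>k\<^esub> (h \<otimes>\<^bsub>group_algebra k G\<^esub> l) (inv\<^bsub>G\<^esub> a \<otimes>\<^bsub>G\<^esub> g)"
        using fin cl by (simp add: k.finsum_rdistr k.m_assoc)
    qed (use cl ga_closed[OF ga_mult_closed[OF h l]] in auto)
    also have "\<dots> = (f \<otimes>\<^bsub>group_algebra k G\<^esub> (h \<otimes>\<^bsub>group_algebra k G\<^esub> l)) g"
      using g by (simp add: group_algebra_def)
    finally show ?thesis .
  qed
qed

lemma ga_one_closed: "\<one>\<^bsub>group_algebra k G\<^esub> \<in> carrier (group_algebra k G)"
proof -
  have "supp k G \<one>\<^bsub>group_algebra k G\<^esub> \<subseteq> {\<one>\<^bsub>G\<^esub>}" by (auto simp: supp_def group_algebra_def)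
  then have "finite (supp k G \<one>\<^bsub>group_algebra k G\<^esub>)" by (rule finite_subset) simp
  then show ?thesis unfolding ga_carrier by (auto simp: group_algebra_def)
qed

lemma ga_l_one: assumes h: "h \<in> carrier (group_algebra k G)" shows "\<one>\<^bsub>group_algebra k G\<^esub> \<otimes>\<^bsub>group_algebra k G\<^esub> h = h"
proof
  fix g
  have s: "supp k G \<one>\<^bsub>group_algebra k G\<^esub> \<subseteq> {\<one>\<^bsub>G\<^esub>}" by (auto simp: supp_def group_algebra_def)
  have o: "\<one>\<^bsub>group_algebra k G\<^esub> \<one>\<^bsub>G\<^esub> = \<one>\<^bsub>k\<^esub>" by (simp add: group_algebra_def)
  show "(\<one>\<^bsub>group_algebra k G\<^esub> \<otimes>\<^bsub>group_algebra k G\<^esub> h) g = h g"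
  proof (cases "g \<in> carrier G")
    case True
    then show ?thesis using ga_mult_superset[OF ga_one_closed h _ s _ True] ga_closed[OF h] o
      by simp
  next
    case False then show ?thesis using h by (simp add: group_algebra_def)
  qed
qed

lemma ga_r_one: assumes h: "h \<in> carrier (group_algebra k G)" shows "h \<otimes>\<^bsub>group_algebra k G\<^esub> \<one>\<^bsub>group_algebra k G\<^esub> = h"
proof
  fix g
  show "(h \<otimes>\<^bsub>group_algebra k G\<^esub> \<one>\<^bsub>group_algebra k G\<^esub>) g = h g"
  proof (cases "g \<in> carrier G")
    case g: True
    let ?S = "insert g (supp k G h)"
    have fin: "finite ?S" using h by (simp add: ga_carrier)
    have "(h \<otimes>\<^bsub>group_algebra k G\<^esub> \<one>\<^bsub>group_algebra k G\<^esub>) g = (\<Oplus>\<^bsub>k\<^esub>a \<in> ?S. h a \<otimes>\<^bsub>k\<^esub> \<one>\<^bsub>group_algebra k G\<^esub> (inv\<^bsub>G\<^esub> a \<otimes>\<^bsub>G\<^esub> g))"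
      by (rule ga_mult_superset[OF h ga_one_closed fin]) (use g in \<open>auto simp: supp_def\<close>)
    also have "\<dots> = (\<Oplus>\<^bsub>k\<^esub>a \<in> ?S. if g = a then h a else \<zero>\<^bsub>k\<^esub>)"
    proof (rule k.finsum_cong')
      fix a assume "a \<in> ?S"
      then have a: "a \<in> carrier G" using g by (auto simp: supp_def)
      have "inv\<^bsub>G\<^esub> a \<otimes>\<^bsub>G\<^esub> g = \<one>\<^bsub>G\<^esub> \<longleftrightarrow> g = a"
        using a g by (metis G.inv_equality G.inv_inv G.inv_closed G.l_inv)
      then show "h a \<otimes>\<^bsub>k\<^esub> \<one>\<^bsub>group_algebra k G\<^esub> (inv\<^bsub>G\<^esub> a \<otimes>\<^bsub>G\<^esub> g) = (if g = a then h a else \<zero>\<^bsub>k\<^esub>)"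
        using ga_closed[OF h] by (simp add: group_algebra_def)
    qed (use ga_closed[OF h] in auto)
    also have "\<dots> = h g"
      by (rule k.add.finprod_singleton) (use fin ga_closed[OF h] in auto)
    finally show ?thesis .
  next
    case False then show ?thesis using h by (simp add: group_algebra_def)
  qed
qed

lemma ga_add: "(f \<oplus>\<^bsub>group_algebra k G\<^esub> h) g = f g \<oplus>\<^bsub>k\<^esub> h g"
  by (simp add: group_algebra_def)

lemma ga_add_closed:
  assumes "f \<in> carrier (group_algebra k G)" "h \<in> carrier (group_algebra k G)" shows "f \<oplus>\<^bsub>group_algebra k G\<^esub> h \<in> carrier (group_algebra k G)"
proof -
  have "supp k G (f \<oplus>\<^bsub>group_algebra k G\<^esub> h) \<subseteq> supp k G f \<union> supp k G h"
    using assms by (auto simp: supp_def ga_add)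
  then have "finite (supp k G (f \<oplus>\<^bsub>group_algebra k G\<^esub> h))"
    by (rule finite_subset) (use assms in \<open>auto simp: ga_carrier\<close>)
  then show ?thesis using assms unfolding ga_carrier by (auto simp: ga_add)
qed

theorem ring_group_algebra: "ring (group_algebra k G)"
proof (rule ringI)
  show "abelian_group (group_algebra k G)"
  proof (rule abelian_groupI)
    fix f assume f: "f \<in> carrier (group_algebra k G)"
    let ?m = "\<lambda>g. \<ominus>\<^bsub>k\<^esub> f g"
    have "supp k G ?m \<subseteq> supp k G f" by (auto simp: supp_def)
    then have "finite (supp k G ?m)" by (rule finite_subset) (use f in \<open>auto simp: ga_carrier\<close>)
    then have "?m \<in> carrier (group_algebra k G)" using f by (auto simp: ga_carrier)
    moreover have "?m \<oplus>\<^bsub>group_algebra k G\<^esub> f = \<zero>\<^bsub>group_algebra k G\<^esub>"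
      using ga_closed[OF f] by (auto simp: group_algebra_def k.l_neg)
    ultimately show "\<exists>y\<in>carrier (group_algebra k G). y \<oplus>\<^bsub>group_algebra k G\<^esub> f = \<zero>\<^bsub>group_algebra k G\<^esub>" by blast
  qed (auto simp: ga_add_closed, auto simp: group_algebra_def supp_def k.a_ac intro!: ext)
  show "monoid (group_algebra k G)"
    by (rule monoidI) (auto simp: ga_mult_closed ga_one_closed ga_mult_assoc ga_l_one ga_r_one)
next
  fix f h l assume f: "f \<in> carrier (group_algebra k G)" and h: "h \<in> carrier (group_algebra k G)" and l: "l \<in> carrier (group_algebra k G)"
  note cl = ga_closed[OF f] ga_closed[OF h] ga_closed[OF l]
  show "(f \<oplus>\<^bsub>group_algebra k G\<^esub> h) \<otimes>\<^bsub>group_algebra k G\<^esub> l = f \<otimes>\<^bsub>group_algebra k G\<^esub> l \<oplus>\<^bsub>group_algebra k G\<^esub> h \<otimes>\<^bsub>group_algebra k G\<^esub> l"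
  proof
    fix g
    let ?S = "supp k G f \<union> supp k G h"
    show "((f \<oplus>\<^bsub>group_algebra k G\<^esub> h) \<otimes>\<^bsub>group_algebra k G\<^esub> l) g = (f \<otimes>\<^bsub>group_algebra k G\<^esub> l \<oplus>\<^bsub>group_algebra k G\<^esub> h \<otimes>\<^bsub>group_algebra k G\<^esub> l) g"
    proof (cases "g \<in> carrier G")
      case g: True
      have S: "finite ?S" "?S \<subseteq> carrier G" using f h by (auto simp: ga_carrier) (auto simp: supp_def)
      have s: "supp k G (f \<oplus>\<^bsub>group_algebra k G\<^esub> h) \<subseteq> ?S" using cl by (auto simp: supp_def ga_add)
      show ?thesis
        unfolding ga_add ga_mult_superset[OF ga_add_closed[OF f h] l S(1) s S(2) g]
          ga_mult_superset[OF f l S(1) Un_upper1 S(2) g] ga_mult_superset[OF h l S(1) Un_upper2 S(2) g]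
        using cl by (subst k.finsum_addf[symmetric]) (auto simp: k.l_distr)
    next
      case False then show ?thesis by (simp add: group_algebra_def)
    qed
  qed
  show "l \<otimes>\<^bsub>group_algebra k G\<^esub> (f \<oplus>\<^bsub>group_algebra k G\<^esub> h) = l \<otimes>\<^bsub>group_algebra k G\<^esub> f \<oplus>\<^bsub>group_algebra k G\<^esub> l \<otimes>\<^bsub>group_algebra k G\<^esub> h"
    using cl by (auto simp: group_algebra_def k.r_distr k.finsum_addf intro!: ext)
qed

lemma group_elem_mult:
  assumes x: "x \<in> carrier G" and y: "y \<in> carrier G"
  shows "group_elem k x \<in> carrier (group_algebra k G)"
    and "group_elem k x \<otimes>\<^bsub>group_algebra k G\<^esub> group_elem k y = group_elem k (x \<otimes>\<^bsub>G\<^esub> y)"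
proof -
  have s: "supp k G (group_elem k x) \<subseteq> {x}" for x by (auto simp: supp_def group_elem_def)
  have c: "group_elem k x \<in> carrier (group_algebra k G)" if "x \<in> carrier G" for x
    using that finite_subset[OF s] unfolding ga_carrier by (auto simp: group_elem_def)
  show "group_elem k x \<in> carrier (group_algebra k G)" using c x by blast
  show "group_elem k x \<otimes>\<^bsub>group_algebra k G\<^esub> group_elem k y = group_elem k (x \<otimes>\<^bsub>G\<^esub> y)"
  proof
    fix g
    show "(group_elem k x \<otimes>\<^bsub>group_algebra k G\<^esub> group_elem k y) g = group_elem k (x \<otimes>\<^bsub>G\<^esub> y) g"
    proof (cases "g \<in> carrier G")
      case g: True
      have "inv\<^bsub>G\<^esub> x \<otimes>\<^bsub>G\<^esub> g = y \<longleftrightarrow> g = x \<otimes>\<^bsub>G\<^esub> y"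
        using x y g by (metis G.inv_solve_left)
      then show ?thesis
        using ga_mult_superset[OF c[OF x] c[OF y] _ s _ g] x
        by (simp add: group_elem_def)
    next
      case False then show ?thesis using x y by (auto simp: group_algebra_def group_elem_def)
    qed
  qed
qed
end

lemma circ_index:
  assumes "i < dim_vec v" "j < dim_vec v"
  shows "circ v $$ (i, j) = v $ ((i + dim_vec v - j) mod dim_vec v)"
proof -
  have d: "dim_vec ((rotate_down ^^ j) v) = dim_vec v" for j
    by (induction j) (auto simp: rotate_down_def)
  have "(rotate_down ^^ j) v $ i = v $ ((i + dim_vec v - j) mod dim_vec v)"
    using assms
  proof (induction j arbitrary: i)
    case 0 then show ?case by simp
  next
    case (Suc j)
    define i' where "i' = (if i = 0 then dim_vec v - 1 else i - 1)"
    have i': "i' < dim_vec v" using Suc.prems by (auto simp: i'_def)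
    have "(i' + dim_vec v - j) mod dim_vec v = (i + dim_vec v - Suc j) mod dim_vec v"
    proof (cases "i = 0")
      case True
      then have "i' + dim_vec v - j = (i + dim_vec v - Suc j) + dim_vec v"
        using Suc.prems by (simp add: i'_def)
      then show ?thesis by simp
    qed (use Suc.prems in \<open>simp add: i'_def\<close>)
    moreover have "(rotate_down ^^ Suc j) v $ i = (rotate_down ^^ j) v $ i'"
      using Suc.prems d by (simp add: rotate_down_def i'_def)
    ultimately show ?case using Suc i' by simp
  qed
  then show ?thesis using assms d by (simp add: circ_def mat_of_cols_index)
qed

lemma circ_carrier: "circ v \<in> carrier_mat (dim_vec v) (dim_vec v)"
  by (auto simp: circ_def)

lemma circulant_iff:
  "n > 0 \<Longrightarrow> A \<in> carrier_mat n n \<Longrightarrow> circulant A \<longleftrightarrow> A = circ (col A 0)"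
proof -
  assume n: "n > 0" and A: "A \<in> carrier_mat n n"
  have d: "dim_vec ((rotate_down ^^ j) v) = dim_vec v" for j and v :: "'a vec"
    by (induction j) (auto simp: rotate_down_def)
  have cc: "col (circ v) j = (rotate_down ^^ j) v" if "j < dim_vec v" for v :: "'a vec" and j
    using that d by (auto simp: circ_def intro!: eq_vecI simp: mat_of_cols_index)
  show ?thesis
  proof
    assume c: "circulant A"
    have *: "col A j = (rotate_down ^^ j) (col A 0)" if "j < n" for j
      using that by (induction j) (use c A in \<open>auto simp: circulant_def\<close>)
    show "A = circ (col A 0)"
    proof (rule mat_col_eqI)
      fix j assume "j < dim_col (circ (col A 0))"
      then have "j < n" using A by (simp add: circ_def)
      then show "col A j = col (circ (col A 0)) j" using *[of j] A by (subst cc) auto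
    qed (use A in \<open>auto simp: circ_def\<close>)
  next
    assume e: "A = circ (col A 0)"
    have "col A (Suc j) = rotate_down (col A j)" if "Suc j < n" for j
      using cc[of j "col A 0"] cc[of "Suc j" "col A 0"] e that A by simp
    then show "circulant A" using A by (auto simp: circulant_def)
  qed
qed

lemma graph_of_biadjacency: "bipartite_graph n E \<Longrightarrow> graph_of_mat (biadjacency n E) = E"
  by (auto simp: graph_of_mat_def biadjacency_def bipartite_graph_def split: if_splits)

lemma num_pseudopaths_1: "num_pseudopaths E 1 i j = (if (i, j) \<in> E then 1 else 0)"
proof -
  have "{es. length es = 1 \<and> pseudopath E i j es} = (if (i, j) \<in> E then {[(i, j)]} else {})"
    by (auto simp: pseudopath_def length_Suc_conv)
  then show ?thesis by (simp add: num_pseudopaths_def)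
qed

lemma finite_pseudopaths:
  assumes "bipartite_graph n E"
  shows "finite {es. length es = r \<and> pseudopath E i j es}"
proof -
  have "finite E" using assms finite_subset unfolding bipartite_graph_def by blast
  then have "finite {es. set es \<subseteq> E \<and> length es = r}" by (rule finite_lists_length_eq)
  then show ?thesis by (rule rev_finite_subset) (auto simp: pseudopath_def)
qed

lemma num_pseudopaths_Suc:
  assumes "bipartite_graph n E" "r > 0" "i < n" 
  shows "num_pseudopaths E (Suc r) i j = (\<Sum>l<n. (if (i, l) \<in> E then 1 else 0) * num_pseudopaths E r l j)"
proof -
  let ?P = "\<lambda>l. {es. length es = r \<and> pseudopath E l j es}"
  have "{es. length es = Suc r \<and> pseudopath E i j es} = (\<Union>l\<in>{l. l < n \<and> (i, l) \<in> E}. (#) (i, l) ` ?P l)"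
    (is "?L = ?R")
  proof (intro equalityI subsetI)
    fix es assume es: "es \<in> ?L"
    then obtain e fs where e: "es = e # fs" "length fs = r" by (auto simp: length_Suc_conv)
    with \<open>r > 0\<close> have ne: "fs \<noteq> []" by auto
    from es e have a: "e \<in> E" "fst e = i" by (auto simp: pseudopath_def)
    then have "snd e < n" using assms(1) by (auto simp: bipartite_graph_def)
    moreover have "pseudopath E (snd e) j fs"
      using es e ne unfolding pseudopath_def
      by (force simp: hd_conv_nth nth_Cons')
    ultimately show "es \<in> ?R" using a e by (cases e) auto
  next
    fix es assume "es \<in> ?R"
    then obtain l fs where l: "(i, l) \<in> E" "es = (i, l) # fs" "length fs = r" "pseudopath E l j fs" by auto
    then show "es \<in> ?L" by (auto simp: pseudopath_def nth_Cons hd_conv_nth split: nat.splits)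
  qed
  moreover have "card ?R = (\<Sum>l\<in>{l. l < n \<and> (i, l) \<in> E}. card ((#) (i, l) ` ?P l))"
    by (rule card_UN_disjoint) (use finite_pseudopaths[OF assms(1)] in auto)
  moreover have "\<dots> = (\<Sum>l\<in>{l. l < n \<and> (i, l) \<in> E}. num_pseudopaths E r l j)"
    by (simp add: num_pseudopaths_def card_image)
  moreover have "\<dots> = (\<Sum>l<n. (if (i, l) \<in> E then 1 else 0) * num_pseudopaths E r l j)"
    by (rule sum.mono_neutral_cong_left) auto
  ultimately show ?thesis by (simp add: num_pseudopaths_def)
qed

lemma num_pseudopaths_mat:
  assumes "bipartite_graph n E" "r > 0" "i < n" "j < n"
  shows "int (num_pseudopaths E r i j) = (biadjacency n E ^\<^sub>m r) $$ (i, j)"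
  using assms(2,3)
proof (induction r arbitrary: i)
  case (Suc r)
  let ?B = "biadjacency n E"
  have B: "?B \<in> carrier_mat n n" by (simp add: biadjacency_def)
  show ?case
  proof (cases "r = 0")
    case True then show ?thesis using Suc.prems assms(4) num_pseudopaths_1[of E i j] B 
      by (simp add: biadjacency_def)
  next
    case False
    have "?B ^\<^sub>m Suc r = ?B * ?B ^\<^sub>m r"
      using B by (induction r) (auto simp: assoc_mult_mat[of _ n n _ n _ n])
    moreover have "int (num_pseudopaths E (Suc r) i j) = (\<Sum>l<n. ?B $$ (i, l) * (?B ^\<^sub>m r) $$ (l, j))"
      using num_pseudopaths_Suc[OF assms(1) _ Suc.prems(2), of r j] False Suc
      by (auto simp: biadjacency_def intro!: sum.cong)
    moreover have "(?B * ?B ^\<^sub>m r) $$ (i, j) = (\<Sum>l<n. ?B $$ (i, l) * (?B ^\<^sub>m r) $$ (l, j))"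
      using B Suc.prems assms(4) pow_carrier_mat[OF B, of r]
      by (auto simp: scalar_prod_def atLeast0LessThan intro!: sum.cong)
    ultimately show ?thesis by simp
  qed
qed simp

end

theory Submission
  imports Defs "HOL-Algebra.QuotRing" "Jordan_Normal_Form.Determinant"
begin

text \<open>
  Every condition in the list speaks about the powers of an element \<open>x\<close> with \<open>x\<^sup>p = 1\<close> in some ring
  of characteristic two: a group element in a group algebra, or the cyclic permutation matrix among
  the \<open>p \<times> p\<close> matrices over the field with two elements, whose polynomial expressions are exactly
  the circulant matrices. All of these are treated at once by evaluating polynomials over that field
  at \<open>x\<close>; the only property of \<open>x\<close> that matters is that \<open>1, x, \<dots>, x\<^bsup>p-1\<^esup>\<close> are linearly independent,
  so that evaluation identifies polynomials modulo \<open>X\<^sup>p + 1\<close> (locale \<open>cyclic_evaluation\<close>). Three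
  observations then carry the proof.

  First, if \<open>p = 2\<^sup>n - 1\<close>, the \<open>n\<close>-fold Frobenius map \<open>q \<mapsto> q\<^bsup>2^n\<^esup>\<close> is additive and fixes \<open>X\<close> modulo
  \<open>X\<^sup>p + 1\<close>, because \<open>X\<^bsup>2^n\<^esup> = X\<^sup>p X\<close>. Hence it fixes every \<open>u = q(x)\<close>, and if \<open>u\<close> is a unit, then
  \<open>u\<^sup>p = 1\<close> (\<open>unit_pow_mersenne\<close>). This gives every statement about all units from the statement that
  \<open>p\<close> is a Mersenne prime.

  Second, \<open>1 + x + x\<^sup>2\<close> is a unit since \<open>3\<close> is prime to \<open>2p\<close> (\<open>trinomial_Units\<close>). If all non-trivial
  units have order \<open>p\<close>, its \<open>p\<close>-th power is \<open>1\<close>, and \<open>(1 + x)(1 + x + x\<^sup>2) = 1 + x\<^sup>3\<close> then yields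
  \<open>(1 + x)\<^sup>p = (1 + x\<^sup>3)\<^sup>p\<close>. Comparing the coefficients of \<open>x\<^bsup>3r\<^esup>\<close> gives the congruences between binomial
  coefficients (\<open>binomial_pow_imp_choose_cong\<close>).

  Third, these congruences force \<open>p\<close> to be a Mersenne prime (\<open>mersenne_prime_if_choose_cong\<close>).
  Write \<open>p + 1 = 2\<^bsup>s+1\<^esup> m\<close> with \<open>m\<close> odd, so that the binary expansion of \<open>p\<close> ends in a zero followed
  by \<open>s + 1\<close> ones unless \<open>m = 1\<close>. At \<open>r = 2\<^sup>s\<close> the binomial coefficient is odd, whereas at \<open>3r\<close> it is
  even, as \<open>3r = 2\<^sup>s + 2\<^bsup>s+1\<^esup>\<close> has a binary digit at the position of that zero; and \<open>3r < p\<close> if \<open>m \<noteq> 1\<close>.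

  For an arbitrary group algebra all of whose non-trivial units have order \<open>p\<close>, the unit \<open>-1\<close> shows
  that the characteristic is two and any non-trivial group element serves as \<open>x\<close>. The statements on
  graphs are the statements on matrices in disguise: modulo two, the number of perfect matchings is
  the determinant of the biadjacency matrix, and pseudopaths are counted by its powers.
\<close>

hide_const (open) Polynomial.order up_ring.coeff up_ring.monom

section \<open>Parity of binomial coefficients\<close>

text \<open>
  The two lowest binary digits in Lucas' theorem for the prime two: a digit one of the lower index
  must sit over a digit one of the upper index.
\<close>

lemma even_choose_double:
  "even ((2 * a) choose (2 * b)) \<longleftrightarrow> even (a choose b)"
  "even ((2 * a) choose (2 * b + 1))"
proof (induction a arbitrary: b)
  case (Suc a)
  have s: "2 * Suc a = Suc (Suc (2 * a))" by simp
  {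
    case 1
    show ?case using Suc[of b] Suc[of "b - 1"] unfolding s by (cases b) auto
  next
    case 2
    show ?case using Suc[of b] Suc[of "b - 1"] unfolding s by (cases b) auto
  }
next
  case 0
  { case 1 show ?case by (cases b) auto }
  { case 2 show ?case by auto }
qed

lemma even_choose_odd_even: "even ((2 * a + 1) choose (2 * b)) \<longleftrightarrow> even (a choose b)"
  using even_choose_double[of a b] even_choose_double[of a "b - 1"] by (cases b) auto

text \<open>
  The \<open>s\<close> lowest binary digits of \<open>2\<^sup>s m - 1\<close> are ones, so they put no condition on the lower index
  and can be stripped off one by one.
\<close>

lemma even_choose_pred_power:
  "m > 0 \<Longrightarrow> even ((2 ^ s * m - 1) choose (2 ^ s * r)) \<longleftrightarrow> even ((m - 1) choose r)"
proof (induction s)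
  case (Suc s)
  have "(2::nat) ^ Suc s * m - 1 = 2 * (2 ^ s * m - 1) + 1"
    using Suc.prems by (cases "2 ^ s * m") (auto simp: algebra_simps)
  moreover have "(2::nat) ^ Suc s * r = 2 * (2 ^ s * r)" by simp
  ultimately show ?case using even_choose_odd_even Suc by metis
qed simp

lemma even_choose_three:
  assumes "m > 0" "odd m"
  shows "even ((2 * m - 1) choose 3)"
proof -
  obtain l where l: "m = Suc l" using assms by (cases m) auto
  have "Suc (2 * l) choose Suc 2 = ((2 * l) choose 2) + ((2 * l) choose Suc 2)"
    by (rule binomial_Suc_Suc)
  then have "even ((2 * l + 1) choose 3) \<longleftrightarrow> even ((2 * l) choose 2)"
    using even_choose_double(2)[of l 1] by simp
  also have "\<dots> \<longleftrightarrow> even (l choose 1)" using even_choose_double(1)[of l 1] by simp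
  finally show ?thesis using assms by (simp add: l)
qed

text \<open>
  The congruence is applied once, at the power of two that sits just below the lowest zero digit of \<open>p\<close>.
  Multiplication by \<open>3\<close> adds a one at that zero, and for a \<open>p\<close> that is not Mersenne the product stays
  below \<open>p\<close>, so that no reduction modulo \<open>p\<close> interferes.
\<close>

lemma mersenne_prime_if_choose_cong:
  assumes "prime p" "p > 3"
    and c: "\<forall>r\<in>{1..p - 1}. [p choose r = p choose (3 * r mod p)] (mod 2)"
  shows "mersenne_prime p"
proof (rule ccontr)
  assume nm: "\<not> mersenne_prime p"
  have "odd p" using assms prime_odd_nat by auto
  obtain m where m: "p + 1 = 2 ^ multiplicity 2 (p + 1) * m" "odd m"
    by (rule multiplicity_decompose'[of "p + 1" "2::nat"]) auto
  define t where "t = multiplicity 2 (p + 1)"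
  have tm: "p + 1 = 2 ^ t * m" "odd m" using m by (simp_all add: t_def)
  have "t > 0" using tm \<open>odd p\<close> by (cases t) auto
  then obtain s where s: "t = Suc s" by (cases t) auto
  have p: "p = 2 ^ t * m - 1" using tm(1) by simp
  have "m \<noteq> 1" using nm p \<open>t > 0\<close> assms(1) unfolding mersenne_prime_def by (metis mult.right_neutral)
  then have "m \<ge> 3" using tm(2) by (cases m rule: nat.exhaust) (auto elim!: oddE)
  then have m3: "m > 0" "2 * m > 0" by auto
  \<comment> \<open>Only \<open>s\<close> of the \<open>s + 1\<close> trailing ones of \<open>p\<close> are stripped off below, which turns \<open>2\<^sup>s\<close> and \<open>3 \<sqdot> 2\<^sup>s\<close>
    into \<open>1\<close> and \<open>3\<close>, over \<open>2m - 1\<close> in place of \<open>p\<close>.\<close>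
  have p': "p = 2 ^ s * (2 * m) - 1" using p s by simp
  have "2 ^ t * 3 \<le> p + 1" unfolding tm(1) using \<open>m \<ge> 3\<close> by simp
  moreover have "(2::nat) ^ s \<ge> 1" by simp
  ultimately have lt: "3 * 2 ^ s < p" unfolding s power_Suc by linarith
  have "(2::nat) ^ s * 1 \<in> {1..p - 1}" using lt by auto
  from bspec[OF c this] have "even (p choose (2 ^ s * 1)) \<longleftrightarrow> even (p choose (2 ^ s * 3))"
    using lt by (auto simp: cong_def mult.commute even_iff_mod_2_eq_zero)
  then have "even ((2 * m - 1) choose 1) \<longleftrightarrow> even ((2 * m - 1) choose 3)"
    unfolding p' even_choose_pred_power[OF m3(2), of s] .
  moreover have "odd ((2 * m - 1) choose 1)" using m3 by simp
  moreover have "even ((2 * m - 1) choose 3)" using m3(1) tm(2) by (rule even_choose_three)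
  ultimately show False by blast
qed

section \<open>Polynomials over the field with two elements\<close>

lemma bit_poly_two [simp]: "(2 :: bit poly) = 0"
proof -
  have "(2 :: bit poly) = [:2:]" by (rule numeral_poly)
  then show ?thesis by simp
qed

lemma bit_poly_add_self [simp]: "q + q = (0 :: bit poly)"
  by (metis mult_2 bit_poly_two mult_zero_left)

lemma bit_poly_add_cancel: "r + q + (r + q') = q + (q' :: bit poly)"
  by (metis (no_types) add.assoc add.left_commute add.right_neutral bit_poly_add_self)

lemma frobenius_add: "(q + r) ^ (2 ^ n) = q ^ (2 ^ n) + (r :: bit poly) ^ (2 ^ n)"
proof (induction n)
  case (Suc n)
  have "(a + b)\<^sup>2 = a\<^sup>2 + b\<^sup>2" for a b :: "bit poly"
    by (simp add: power2_sum)
  then show ?case by (simp only: power_Suc2 power_mult Suc.IH)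
qed simp

abbreviation bX :: "bit poly" where "bX \<equiv> [:0, 1:]"

text \<open>
  Since \<open>X\<^bsup>2^n\<^esup> = X\<^sup>p X\<close>, the Frobenius power fixes \<open>X\<close> modulo \<open>X\<^sup>p + 1\<close>; it fixes the constants and is
  additive and multiplicative, hence fixes everything. In characteristic two the sum of two
  polynomials is also their difference, so divisibility of a sum expresses a congruence.
\<close>

lemma frobenius_fixed_mod:
  assumes "p = 2 ^ n - 1"
  shows "bX ^ p + 1 dvd q ^ (2 ^ n) + q"
proof (induction q)
  case 0 show ?case by (simp add: power_0_left)
next
  case (pCons a q)
  define k :: nat where "k = 2 ^ n"
  have "k > 0" by (simp add: k_def)
  have pq: "pCons a q = [:a:] + bX * q" by simp
  have a: "[:a:] ^ k = [:a:]" by (cases a) (use \<open>k > 0\<close> in \<open>auto simp: power_0_left one_pCons[symmetric]\<close>)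
  have X: "bX ^ k = bX ^ p * bX" using assms \<open>k > 0\<close> unfolding k_def
    by (metis power_minus_mult)
  have "(pCons a q) ^ k + pCons a q = bX ^ k * q ^ k + bX * q"
    unfolding pq k_def frobenius_add power_mult_distrib a[unfolded k_def]
    by (rule bit_poly_add_cancel)
  \<comment> \<open>The mixed term is inserted twice, which adds zero.\<close>
  also have "\<dots> = (bX * q ^ k + bX ^ k * q ^ k) + (bX * q ^ k + bX * q)"
    by (rule bit_poly_add_cancel[symmetric])
  also have "\<dots> = (bX ^ p + 1) * (bX * q ^ k) + bX * (q ^ k + q)"
    unfolding X by (simp only: algebra_simps mult_1_left)
  also have "bX ^ p + 1 dvd \<dots>"
    using pCons.IH unfolding k_def by (rule dvd_add[OF dvd_triv_left dvd_mult])
  finally show ?case unfolding k_def .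
qed

lemma geometric_bit_poly: "([:1, 1:] :: bit poly) * (\<Sum>i<n. bX ^ i) = bX ^ n + 1"
proof (induction n)
  case (Suc n)
  have "[:1, 1:] = bX + 1" by (simp add: one_pCons)
  then show ?case using Suc by (simp add: algebra_simps)
qed simp

lemma bX_power_dvd: "bX ^ p + 1 dvd bX ^ (p * m) + 1"
proof (induction m)
  case (Suc m)
  have "bX ^ (p * Suc m) + 1 = bX ^ p * (bX ^ (p * m) + 1) + (bX ^ p + 1)"
    by (simp add: algebra_simps power_add)
  then show ?case using Suc by (metis dvd_add dvd_mult dvd_refl)
qed simp

lemma bX_power_mod_dvd: "bX ^ p + 1 dvd bX ^ a + bX ^ (a mod p)"
proof -
  have "bX ^ a = bX ^ (p * (a div p)) * bX ^ (a mod p)" by (simp flip: power_add)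
  then have "bX ^ a + bX ^ (a mod p) = (bX ^ (p * (a div p)) + 1) * bX ^ (a mod p)"
    by (simp only: distrib_right mult_1_left)
  then show ?thesis using bX_power_dvd[of p "a div p"] by (metis dvd_mult2)
qed

text \<open>
  Formally \<open>1 + X + X\<^sup>2 = (X\<^sup>3 + 1) / (X + 1)\<close>, with inverse \<open>(X + 1) / (X\<^sup>3 + 1)\<close>. Replacing the numerator
  by \<open>X\<^bsup>3k\<^esup> + 1\<close> with \<open>3k \<equiv> 1\<close> modulo \<open>p\<close> makes the inverse a geometric sum in \<open>X\<^sup>3\<close>. As \<open>X + 1\<close> is a zero
  divisor modulo \<open>X\<^sup>p + 1\<close>, this could fail by a multiple of \<open>1 + X + \<dots> + X\<^bsup>p-1\<^esup>\<close>; choosing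
  \<open>3k \<equiv> 1\<close> modulo \<open>2p\<close> makes that multiple even.
\<close>

lemma trinomial_invertible_mod:
  assumes "prime p" "p > 3"
  shows "\<exists>w. bX ^ p + 1 dvd [:1, 1, 1:] * w + 1"
proof -
  have "\<not> 3 dvd 2 * p" using assms prime_dvd_mult_nat[of 3 2 p] prime_nat_not_dvd[of p 3] by auto
  then have "coprime 3 (2 * p)" by (intro prime_imp_coprime) auto
  from cong_solve_coprime_nat[OF this] obtain k where k: "[3 * k = Suc 0] (mod 2 * p)" by blast
  then have "k > 0" using assms by (cases k) (auto simp: cong_def)
  with k obtain m where m: "3 * k = 1 + (p * m) * 2"
  proof -
    have "2 * p dvd 3 * k - 1" using k cong_to_1_nat by simp
    then obtain m where "3 * k - 1 = 2 * p * m" by (rule dvdE)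
    then show ?thesis using that[of m] \<open>k > 0\<close> by simp
  qed
  define w where "w = (\<Sum>i<k. (bX ^ 3) ^ i)"
  have w3: "(bX ^ 3 + 1) * w = (bX ^ 3) ^ k + 1"
    unfolding w_def
  proof (induction k)
    case (Suc k)
    then show ?case by (simp add: algebra_simps)
  qed simp
  have X3: "[:1, 1:] * [:1, 1, 1:] = bX ^ 3 + 1" by (simp add: numeral_3_eq_3 one_pCons)
  have "[:1, 1:] * ([:1, 1, 1:] * w + 1) = bX ^ (3 * k) + bX"
  proof -
    have "[:1, 1:] * ([:1, 1, 1:] * w + 1) = (bX ^ 3 + 1) * w + [:1, 1:]"
      by (simp only: distrib_left mult.assoc[symmetric] X3 mult_1_right)
    also have "\<dots> = (1 + bX ^ (3 * k)) + (1 + bX)"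
      by (simp only: w3 power_mult) (simp add: one_pCons add.commute)
    finally show ?thesis by (simp only: bit_poly_add_cancel)
  qed
  also have "\<dots> = bX * (bX ^ (p * m) + 1) ^ 2"
    unfolding m power_add power_mult power2_sum by (simp add: algebra_simps power_mult)
  also have "\<dots> = [:1, 1:] * (bX * (\<Sum>i<p * m. bX ^ i) * (bX ^ (p * m) + 1))"
    unfolding power2_eq_square by (subst geometric_bit_poly[symmetric]) (simp only: mult_ac)
  finally have "[:1, 1, 1:] * w + 1 = bX * (\<Sum>i<p * m. bX ^ i) * (bX ^ (p * m) + 1)"
    by (subst (asm) mult_cancel_left) auto
  moreover have "bX ^ p + 1 dvd bX ^ (p * m) + 1" by (rule bX_power_dvd)
  ultimately show ?thesis by (metis dvd_mult)
qed

section \<open>Evaluation at an element of a ring of characteristic two\<close>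

text \<open>
  The setting includes full matrix rings and group algebras of arbitrary groups: the powers of a single
  element commute, which makes evaluation multiplicative in every ring.
\<close>

locale char_two_evaluation = ring +
  fixes x
  assumes x: "x \<in> carrier R" and char_two: "\<one> \<oplus> \<one> = \<zero>"
begin

definition scalar :: "bit \<Rightarrow> 'a" where "scalar b = (if b = 1 then \<one> else \<zero>)"

definition ev :: "bit poly \<Rightarrow> 'a" where
  "ev q = fold_coeffs (\<lambda>b v. scalar b \<oplus> x \<otimes> v) q \<zero>"

lemma scalar_closed [simp]: "scalar b \<in> carrier R" by (simp add: scalar_def)

lemma scalar_simps [simp]: "scalar 0 = \<zero>" "scalar 1 = \<one>" by (simp_all add: scalar_def)

lemma ev_0 [simp]: "ev 0 = \<zero>" by (simp add: ev_def)

lemma ev_pCons: "ev (pCons a q) = scalar a \<oplus> x \<otimes> ev q"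
  using x by (cases "a = 0 \<and> q = 0") (auto simp: ev_def)

lemma ev_closed [simp]: "ev q \<in> carrier R"
  using x by (induction q) (auto simp: ev_pCons)

lemma scalar_add: "scalar (a + b) = scalar a \<oplus> scalar b"
  using char_two by (cases a; cases b) auto

lemma add_one_one: "a \<in> carrier R \<Longrightarrow> \<one> \<oplus> (\<one> \<oplus> a) = a"
  by (simp add: char_two a_assoc[symmetric])

lemma ev_add: "ev (q + r) = ev q \<oplus> ev r"
  using x add_one_one[of "x \<otimes> ev u \<oplus> x \<otimes> ev v" for u v]
  by (induction q r rule: poly_induct2) (auto simp: ev_pCons scalar_add r_distr a_ac)

lemma ev_smult: "ev (smult a q) = scalar a \<otimes> ev q"
  by (cases a) auto

lemma ev_mult: "ev (q * r) = ev q \<otimes> ev r"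
  using x by (induction q) (auto simp: ev_pCons ev_add ev_smult l_distr m_assoc)

lemma ev_1 [simp]: "ev 1 = \<one>"
  using x by (simp only: one_pCons ev_pCons ev_0 scalar_simps r_null r_zero one_closed)

lemma ev_power: "ev (q ^ n) = ev q [^] n"
  by (induction n) (simp_all add: ev_mult power_Suc2 del: power_Suc)

lemma ev_bX: "ev bX = x"
  using x by (simp add: ev_pCons)

lemma ev_commute: "ev q \<otimes> ev r = ev r \<otimes> ev q"
  by (metis ev_mult mult.commute)

end

text \<open>
  For a prime \<open>p\<close> the order of a non-trivial element is \<open>p\<close> as soon as it divides \<open>p\<close>. The group
  version serves the group of circulant units, the other one the full unit groups.
\<close>

lemma (in group) ord_prime_iff:
  assumes "prime p" "u \<in> carrier G" "u \<noteq> \<one>"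
  shows "ord u = p \<longleftrightarrow> u [^] p = \<one>"
proof -
  have "ord u \<noteq> 1" using assms(2,3) ord_eq_1 by simp
  then have "ord u = p \<longleftrightarrow> ord u dvd p" using assms(1) by (auto simp: prime_nat_iff)
  then show ?thesis using pow_eq_id[OF assms(2), of p] by simp
qed

lemma (in monoid) ord_units_prime_iff:
  assumes "prime p" "u \<in> Units G" "u \<noteq> \<one>"
  shows "group.ord (units_of G) u = p \<longleftrightarrow> u [^] p = \<one>"
  using group.ord_prime_iff[OF units_group assms(1), of u] assms(2,3)
  by (simp add: units_of_carrier units_of_one units_of_pow)

text \<open>
  By independence, evaluation at \<open>x\<close> has kernel exactly the multiples of \<open>X\<^sup>p + 1\<close>: its image is a copy
  of the group algebra of the cyclic group of order \<open>p\<close> over the field with two elements.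
\<close>

locale cyclic_evaluation = char_two_evaluation +
  fixes p :: nat
  assumes prime_p: "prime p" and p_gt_3: "p > 3"
    and x_pow_p: "x [^] p = \<one>"
    and independent: "\<And>q. degree q < p \<Longrightarrow> ev q = \<zero> \<Longrightarrow> q = 0"
begin

lemma ev_cong:
  assumes "bX ^ p + 1 dvd q + r"
  shows "ev q = ev r"
proof -
  obtain s where s: "q + r = (bX ^ p + 1) * s" using assms by (rule dvdE)
  have "q = (q + r) + r" by (simp add: add.assoc)
  then have "q = (bX ^ p + 1) * s + r" by (simp only: s)
  then have "ev q = (x [^] p \<oplus> \<one>) \<otimes> ev s \<oplus> ev r"
    by (simp only: ev_add ev_mult ev_power ev_bX ev_1)
  then show ?thesis by (simp only: x_pow_p char_two l_null l_zero ev_closed)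
qed

text \<open>
  The \<open>2\<^sup>n\<close>-th power of \<open>u\<close> is \<open>u\<close> itself, and \<open>2\<^sup>n = p + 1\<close>; cancel one factor \<open>u\<close>.
\<close>

lemma unit_pow_mersenne:
  assumes "p = 2 ^ n - 1" "ev q \<in> Units R"
  shows "ev q [^] p = \<one>"
proof -
  have "2 ^ n = Suc p" using assms(1) by simp
  moreover have "ev (q ^ 2 ^ n) = ev q"
    using frobenius_fixed_mod[OF assms(1)] by (rule ev_cong)
  ultimately have "ev q [^] Suc p = ev q" by (simp only: ev_power)
  then have "ev q \<otimes> ev q [^] p = ev q \<otimes> \<one>" by (subst (asm) nat_pow_Suc2) simp_all
  then show ?thesis using assms(2) by (subst (asm) Units_l_cancel) simp_all
qed

lemma trinomial_Units: "ev [:1, 1, 1:] \<in> Units R"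
proof -
  obtain w where "bX ^ p + 1 dvd [:1, 1, 1:] * w + 1" using trinomial_invertible_mod prime_p p_gt_3 by blast
  then have "ev [:1, 1, 1:] \<otimes> ev w = \<one>" using ev_cong ev_mult ev_1 by metis
  then show ?thesis
    using ev_commute unfolding Units_def by (auto intro!: bexI[of _ "ev w"])
qed

lemma trinomial_pow_imp_binomial_pow:
  assumes "ev [:1, 1, 1:] [^] p = \<one>"
  shows "ev [:1, 1:] [^] p = ev [:1, 0, 0, 1:] [^] p"
proof -
  have "[:1, 0, 0, 1:] ^ p = [:1, 1:] ^ p * ([:1, 1, 1:] :: bit poly) ^ p"
    by (simp flip: power_mult_distrib)
  then have "ev ([:1, 0, 0, 1:] ^ p) = ev ([:1, 1:] ^ p) \<otimes> ev ([:1, 1, 1:] ^ p)" by (simp only: ev_mult)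
  then show ?thesis using assms by (simp add: ev_power)
qed

text \<open>
  Both sides are expanded by the binomial theorem. The first and the last term evaluate to \<open>1\<close> each and
  cancel in characteristic two. Exponents \<open>3r\<close> are reduced modulo \<open>p\<close>, which permutes \<open>1, \<dots>, p - 1\<close>, so
  independence allows to compare the coefficients of \<open>x\<^bsup>3r mod p\<^esup>\<close>.
\<close>

lemma binomial_pow_imp_choose_cong:
  assumes "ev [:1, 1:] [^] p = ev [:1, 0, 0, 1:] [^] p"
  shows "\<forall>r\<in>{1..p - 1}. [p choose r = p choose (3 * r mod p)] (mod 2)"
proof
  define b :: "nat \<Rightarrow> bit" where "b r = of_nat (p choose r)" for r
  define A where "A = (\<Sum>r\<in>{1..p - 1}. monom (b r) r)"
  define B where "B = (\<Sum>r\<in>{1..p - 1}. monom (b r) (3 * r mod p))"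
  have three: "\<not> p dvd 3" using p_gt_3 by (auto dest: dvd_imp_le)
  have inj: "3 * k mod p = 3 * r mod p \<longleftrightarrow> k = r" if "k < p" "r < p" for k r
    using that cong_mult_lcancel_nat[of 3 p k r] prime_imp_coprime[OF prime_p three]
    by (auto simp: cong_def coprime_commute)
  have binom: "(q + 1) ^ p = 1 + q ^ p + (\<Sum>r\<in>{1..p - 1}. [:b r:] * q ^ r)" for q :: "bit poly"
  proof -
    have "{..p} = insert 0 (insert p {1..p - 1})" using p_gt_3 by auto
    then show ?thesis unfolding binomial_ring
      using p_gt_3 by (simp add: b_def of_nat_poly add.assoc)
  qed
  have ev_sum: "ev (sum f I) = ev (sum g I)" if "finite I" "\<And>i. i \<in> I \<Longrightarrow> ev (f i) = ev (g i)"
    for I and f g :: "nat \<Rightarrow> bit poly"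
    using that by (induction I rule: finite_induct) (auto simp: ev_add)
  have deg: "degree A < p" "degree B < p" unfolding A_def B_def
    using p_gt_3 by (auto intro!: degree_sum_less le_less_trans[OF degree_monom_le])
  have vanish: "ev ((q + 1) ^ p) = ev (\<Sum>r\<in>{1..p - 1}. [:b r:] * q ^ r)" if "ev q [^] p = \<one>" for q
    unfolding binom ev_add[of "1 + q ^ p"] using that by (simp add: ev_add ev_power char_two)
  have "(x [^] (3::nat)) [^] p = \<one>"
    using x x_pow_p by (metis mult.commute nat_pow_one nat_pow_pow)
  then have x3: "ev (bX ^ 3) [^] p = \<one>" by (simp only: ev_power ev_bX)
  have "ev A = ev ((bX + 1) ^ p)"
    unfolding vanish[of bX, unfolded ev_bX, OF x_pow_p] A_def
    by (rule arg_cong[of _ _ ev], rule sum.cong) (auto simp: monom_altdef)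
  also have "\<dots> = ev ((bX ^ 3 + 1) ^ p)"
    using assms by (simp add: ev_power one_pCons numeral_3_eq_3)
  also have "\<dots> = ev B"
    unfolding vanish[OF x3] B_def
  proof (rule ev_sum)
    fix r
    have "ev ((bX ^ 3) ^ r) = ev (bX ^ (3 * r mod p))"
      unfolding power_mult[symmetric] by (rule ev_cong) (rule bX_power_mod_dvd)
    moreover have "monom (b r) (3 * r mod p) = [:b r:] * bX ^ (3 * r mod p)"
      by (simp add: monom_altdef)
    ultimately show "ev ([:b r:] * (bX ^ 3) ^ r) = ev (monom (b r) (3 * r mod p))"
      by (simp only: ev_mult)
  qed simp
  finally have "ev (A + B) = ev (B + B)" by (simp only: ev_add)
  then have "A + B = 0" using independent[of "A + B"] deg degree_add_less[of A p B] by simp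
  then have AB: "A = B" by (metis add.assoc add.right_neutral bit_poly_add_self)
  fix r assume r: "r \<in> {1..p - 1}"
  have "\<not> p dvd 3 * r" using r three prime_p by (auto simp: prime_dvd_mult_iff dest: dvd_imp_le)
  then have "3 * r mod p > 0" by (simp add: mod_greater_zero_iff_not_dvd)
  moreover have "3 * r mod p < p" using p_gt_3 by (intro mod_less_divisor) linarith
  ultimately have r3: "3 * r mod p \<in> {1..p - 1}" by auto
  have "coeff A s = (\<Sum>k\<in>{1..p - 1}. if k = s then b k else 0)" for s
    unfolding A_def coeff_sum by (rule sum.cong) auto
  then have "coeff A s = b s" if "s \<in> {1..p - 1}" for s using that by simp
  then have "coeff A (3 * r mod p) = b (3 * r mod p)" using r3 by blast
  moreover have "coeff B (3 * r mod p) = (\<Sum>k\<in>{1..p - 1}. if k = r then b k else 0)"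
    unfolding B_def coeff_sum by (rule sum.cong) (use inj r in auto)
  then have "coeff B (3 * r mod p) = b r" using r by simp
  ultimately have "b (3 * r mod p) = b r" using AB by simp
  then have "even (b (3 * r mod p)) = even (b r)" by (rule arg_cong)
  then show "[p choose r = p choose (3 * r mod p)] (mod 2)"
    by (simp only: b_def cong_def even_of_nat_iff mod_2_eq_odd)
qed

text \<open>
  Reduction modulo \<open>X\<^sup>p + 1\<close> leaves polynomials of degree below \<open>p\<close>, for which values can be computed
  explicitly in each concrete ring.
\<close>

lemma ev_reduce: "\<exists>r. degree r < p \<and> ev r = ev q"
proof -
  let ?N = "bX ^ p + 1"
  have "bX ^ p = monom 1 p" by (simp add: monom_altdef)
  then have "degree ?N = p" "?N \<noteq> 0" using p_gt_3
    by (auto simp: degree_add_eq_left degree_monom_eq dest: arg_cong[of _ _ degree])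
  then have "degree (q mod ?N) < p" using degree_mod_less[of ?N q] p_gt_3 by auto
  moreover have "q mod ?N + q = ?N * (q div ?N)"
    using minus_mod_eq_mult_div[of q ?N] by (simp add: poly_eq_iff add.commute)
  then have "ev (q mod ?N) = ev q" by (intro ev_cong) simp
  ultimately show ?thesis by blast
qed

lemma ev_trinomial: "ev [:1, 1, 1:] = \<one> \<oplus> x \<oplus> x [^] (2::nat)"
  using x by (simp add: ev_pCons r_distr a_assoc numeral_2_eq_2)

lemma ev_binomial: "ev [:1, 1:] = \<one> \<oplus> x"
  using x by (simp add: ev_pCons)

lemma ev_binomial_cube: "ev [:1, 0, 0, 1:] = \<one> \<oplus> x [^] (3::nat)"
  using x by (simp add: ev_pCons m_assoc numeral_3_eq_3)

lemma nontrivial_units_imp_trinomial_pow: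
  assumes "nontrivial_units_have_order R p"
  shows "ev [:1, 1, 1:] [^] p = \<one>"
  using assms ord_units_prime_iff[OF prime_p trinomial_Units] trinomial_Units
  by (cases "ev [:1, 1, 1:] = \<one>") (auto simp: nontrivial_units_have_order_def)

text \<open>
  If evaluation is onto, every unit is covered by \<open>unit_pow_mersenne\<close>.
\<close>

lemma mersenne_imp_nontrivial_units:
  assumes "mersenne_prime p" "carrier R \<subseteq> range ev"
  shows "nontrivial_units_have_order R p"
  unfolding nontrivial_units_have_order_def
proof (intro ballI impI)
  fix u assume u: "u \<in> Units R" "u \<noteq> \<one>"
  obtain n where n: "p = 2 ^ n - 1" using assms(1) by (auto simp: mersenne_prime_def)
  obtain q where "u = ev q" using u assms(2) Units_closed by blast
  then show "group.ord (units_of R) u = p"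
    using unit_pow_mersenne[OF n] ord_units_prime_iff[OF prime_p u] u by simp
qed

end

section \<open>Group algebras of characteristic two\<close>

text \<open>
  Multiplication by a group element translates the coefficient function; this makes the coefficients
  of \<open>q(g)\<close> accessible by induction on \<open>q\<close>.
\<close>

lemma group_elem_mult_apply:
  assumes "cring k" "group G" "g \<in> carrier G" "h \<in> carrier (group_algebra k G)" "y \<in> carrier G"
  shows "(group_elem k g \<otimes>\<^bsub>group_algebra k G\<^esub> h) y = h (inv\<^bsub>G\<^esub> g \<otimes>\<^bsub>G\<^esub> y)"
proof -
  interpret k: cring k by fact
  interpret G: group G by fact
  have "(group_elem k g \<otimes>\<^bsub>group_algebra k G\<^esub> h) y
      = (\<Oplus>\<^bsub>k\<^esub>a \<in> {g}. group_elem k g a \<otimes>\<^bsub>k\<^esub> h (inv\<^bsub>G\<^esub> a \<otimes>\<^bsub>G\<^esub> y))"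
    using assms by (intro ga_mult_superset group_elem_mult) (auto simp: supp_def group_elem_def)
  then show ?thesis using assms by (simp add: group_elem_def ga_closed)
qed

lemma group_algebra_zero_apply: "\<zero>\<^bsub>group_algebra k G\<^esub> y = \<zero>\<^bsub>k\<^esub>"
  by (simp add: group_algebra_def)

lemma group_elem_one: "group_elem k \<one>\<^bsub>G\<^esub> = \<one>\<^bsub>group_algebra k G\<^esub>"
  by (simp add: group_elem_def group_algebra_def)

lemma group_elem_pow:
  assumes "cring k" "group G" "g \<in> carrier G"
  shows "group_elem k g [^]\<^bsub>group_algebra k G\<^esub> n = group_elem k (g [^]\<^bsub>G\<^esub> (n::nat))"
proof -
  interpret A: ring "group_algebra k G" using assms by (intro ring_group_algebra)
  interpret G: group G by fact
  show ?thesis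
  proof (induction n)
    case 0 show ?case by (simp add: group_elem_one)
  qed (use assms in \<open>simp add: group_elem_mult\<close>)
qed

text \<open>
  Inside the group algebra of any group over any field of characteristic two, an element \<open>g\<close> of prime
  order \<open>p\<close> generates a copy of the group algebra of the cyclic group over the field with two elements.
\<close>

locale group_algebra_char_two = k: field k + G: group G for k G +
  fixes g and p :: nat
  assumes g: "g \<in> carrier G" "g \<noteq> \<one>\<^bsub>G\<^esub>" and g_pow: "g [^]\<^bsub>G\<^esub> p = \<one>\<^bsub>G\<^esub>"
    and prime: "prime p" and gt_3: "p > 3"
    and char_2: "\<one>\<^bsub>k\<^esub> \<oplus>\<^bsub>k\<^esub> \<one>\<^bsub>k\<^esub> = \<zero>\<^bsub>k\<^esub>"
begin

abbreviation "A \<equiv> group_algebra k G"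

sublocale A: ring A
  by (rule ring_group_algebra) unfold_locales

sublocale A: char_two_evaluation A "group_elem k g"
proof
  show "group_elem k g \<in> carrier A" using g by (intro group_elem_mult) unfold_locales
  show "\<one>\<^bsub>A\<^esub> \<oplus>\<^bsub>A\<^esub> \<one>\<^bsub>A\<^esub> = \<zero>\<^bsub>A\<^esub>"
    using char_2 by (auto simp: group_algebra_def)
qed

lemma pow_eq_one_iff: "g [^]\<^bsub>G\<^esub> n = \<one>\<^bsub>G\<^esub> \<longleftrightarrow> p dvd n"
proof -
  have "G.ord g dvd p" using G.pow_eq_id[OF g(1)] g_pow by blast
  moreover have "G.ord g \<noteq> 1" using G.ord_eq_1 g by blast
  ultimately have "G.ord g = p" using prime by (auto simp: prime_nat_iff)
  then show ?thesis using G.pow_eq_id[OF g(1)] by simp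
qed

text \<open>
  The degree bound prevents exponents from wrapping around, so the coefficients of \<open>q(g)\<close> are those of \<open>q\<close>.
  In the induction step, the only value that could wrap around is that of \<open>g\<^bsup>p-1\<^esup>\<close>, whose coefficient
  vanishes.
\<close>

lemma ev_apply:
  "degree q < p \<Longrightarrow> r < p \<Longrightarrow> A.ev q (g [^]\<^bsub>G\<^esub> r) = (if coeff q r = 1 then \<one>\<^bsub>k\<^esub> else \<zero>\<^bsub>k\<^esub>)"
proof (induction q arbitrary: r)
  case 0 then show ?case by (simp add: group_algebra_zero_apply)
next
  case (pCons a q)
  have deg: "degree q < p" using pCons.prems by (auto split: if_splits)
  have "A.ev (pCons a q) (g [^]\<^bsub>G\<^esub> r)
      = A.scalar a (g [^]\<^bsub>G\<^esub> r) \<oplus>\<^bsub>k\<^esub> (group_elem k g \<otimes>\<^bsub>A\<^esub> A.ev q) (g [^]\<^bsub>G\<^esub> r)"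
    by (simp only: A.ev_pCons ga_add[OF k.is_cring G.is_group])
  also have "(group_elem k g \<otimes>\<^bsub>A\<^esub> A.ev q) (g [^]\<^bsub>G\<^esub> r) = A.ev q (inv\<^bsub>G\<^esub> g \<otimes>\<^bsub>G\<^esub> g [^]\<^bsub>G\<^esub> r)"
    using g by (intro group_elem_mult_apply) (unfold_locales, auto)
  also have "A.scalar a (g [^]\<^bsub>G\<^esub> r) = (if a = 1 \<and> r = 0 then \<one>\<^bsub>k\<^esub> else \<zero>\<^bsub>k\<^esub>)"
    using pCons.prems pow_eq_one_iff[of r]
    by (auto simp: A.scalar_def group_algebra_zero_apply group_elem_one[symmetric] group_elem_def
        dest: dvd_imp_le)
  also have "A.ev q (inv\<^bsub>G\<^esub> g \<otimes>\<^bsub>G\<^esub> g [^]\<^bsub>G\<^esub> r)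
      = (if r \<noteq> 0 \<and> coeff q (r - 1) = 1 then \<one>\<^bsub>k\<^esub> else \<zero>\<^bsub>k\<^esub>)"
  proof (cases r)
    case 0
    have "g \<otimes>\<^bsub>G\<^esub> g [^]\<^bsub>G\<^esub> (p - 1) = \<one>\<^bsub>G\<^esub>"
      using g_pow gt_3 g by (subst G.nat_pow_Suc2[symmetric]) auto
    then have "inv\<^bsub>G\<^esub> g = g [^]\<^bsub>G\<^esub> (p - 1)" using g
      by (metis G.inv_equality G.inv_inv G.nat_pow_closed)
    moreover have "coeff q (p - 1) = 0"
      using pCons.prems by (cases "q = 0") (auto intro!: coeff_eq_0)
    ultimately show ?thesis using 0 pCons.IH[OF deg, of "p - 1"] gt_3 g by simp
  next
    case (Suc r')
    have "inv\<^bsub>G\<^esub> g \<otimes>\<^bsub>G\<^esub> g [^]\<^bsub>G\<^esub> r = g [^]\<^bsub>G\<^esub> r'"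
      unfolding Suc using g by (subst G.nat_pow_Suc2) (auto simp flip: G.m_assoc)
    then show ?thesis using Suc pCons.IH[OF deg, of r'] pCons.prems by simp
  qed
  finally show ?case by (cases r) auto
qed

sublocale A: cyclic_evaluation A "group_elem k g" p
proof
  show "group_elem k g [^]\<^bsub>A\<^esub> p = \<one>\<^bsub>A\<^esub>"
    using g_pow group_elem_pow[OF k.is_cring G.is_group g(1), of p]
    by (simp add: group_elem_one)
  fix q assume q: "degree q < p" "A.ev q = \<zero>\<^bsub>A\<^esub>"
  have "coeff q r = 0" for r
  proof (cases "r < p")
    case True
    then show ?thesis using ev_apply[OF q(1) True] q(2)
      by (auto simp: group_algebra_zero_apply split: if_splits)
  qed (use q in \<open>auto intro: coeff_eq_0\<close>)
  then show "q = 0" by (simp add: poly_eq_iff)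
qed (fact prime gt_3)+

text \<open>
  Over the field with two elements and for a group generated by \<open>g\<close>, every element of the group algebra
  is the value at \<open>g\<close> of the polynomial with the same coefficients.
\<close>

lemma mersenne_imp_units:
  assumes "mersenne_prime p" "carrier k = {\<zero>\<^bsub>k\<^esub>, \<one>\<^bsub>k\<^esub>}"
    and "carrier G = range (\<lambda>n::nat. g [^]\<^bsub>G\<^esub> n)"
  shows "nontrivial_units_have_order A p"
proof (rule A.mersenne_imp_nontrivial_units[OF assms(1)], rule subsetI)
  fix f assume f: "f \<in> carrier A"
  define q :: "bit poly" where "q = (\<Sum>i<p. monom (if f (g [^]\<^bsub>G\<^esub> i) = \<one>\<^bsub>k\<^esub> then 1 else 0) i)"
  have deg: "degree q < p" unfolding q_def
    using gt_3 by (auto intro!: degree_sum_less le_less_trans[OF degree_monom_le])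
  have "coeff q r = (\<Sum>i<p. if i = r then if f (g [^]\<^bsub>G\<^esub> r) = \<one>\<^bsub>k\<^esub> then 1 else 0 else 0)" for r
    unfolding q_def coeff_sum by (rule sum.cong) auto
  then have coeff: "coeff q r = (if f (g [^]\<^bsub>G\<^esub> r) = \<one>\<^bsub>k\<^esub> then 1 else 0)" if "r < p" for r
    using that by simp
  have "f y = A.ev q y" for y
  proof (cases "y \<in> carrier G")
    case True
    then obtain n :: nat where n: "y = g [^]\<^bsub>G\<^esub> n" using assms(3) by blast
    have "g [^]\<^bsub>G\<^esub> n = (g [^]\<^bsub>G\<^esub> p) [^]\<^bsub>G\<^esub> (n div p) \<otimes>\<^bsub>G\<^esub> g [^]\<^bsub>G\<^esub> (n mod p)"
      using g by (simp add: G.nat_pow_pow G.nat_pow_mult)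
    then have y: "y = g [^]\<^bsub>G\<^esub> (n mod p)" using n g g_pow by simp
    have np: "n mod p < p" using gt_3 by simp
    have "f y \<in> {\<zero>\<^bsub>k\<^esub>, \<one>\<^bsub>k\<^esub>}" using ga_closed[OF k.is_cring G.is_group f] assms(2) by blast
    then show ?thesis using ev_apply[OF deg np] coeff[OF np] unfolding y by auto
  next
    case False
    then show ?thesis using f A.ev_closed[of q] ga_carrier[OF k.is_cring G.is_group] by metis
  qed
  then show "f \<in> range A.ev" by blast
qed

end

text \<open>
  Group elements are units, hence a non-trivial one has order \<open>p\<close>. The unit \<open>-1\<close> satisfies \<open>(-1)\<^sup>2 = 1\<close>
  and \<open>(-1)\<^sup>p = 1\<close> with \<open>p\<close> odd, so \<open>-1 = 1\<close> and the characteristic is two.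
\<close>

lemma choose_cong_if_nontrivial_units:
  assumes "group G" "\<not> trivial_group G" "field k" and "prime p" "p > 3"
    and units: "nontrivial_units_have_order (group_algebra k G) p"
  shows "\<forall>r\<in>{1..p - 1}. [p choose r = p choose (3 * r mod p)] (mod 2)"
proof -
  interpret k: field k by fact
  interpret G: group G by fact
  let ?A = "group_algebra k G"
  interpret A: ring ?A by (rule ring_group_algebra) unfold_locales
  obtain g where g: "g \<in> carrier G" "g \<noteq> \<one>\<^bsub>G\<^esub>"
    using assms(1,2) unfolding trivial_group_def by auto
  have pow: "u [^]\<^bsub>?A\<^esub> p = \<one>\<^bsub>?A\<^esub>" if "u \<in> Units ?A" for u
    using that units A.ord_units_prime_iff[OF \<open>prime p\<close> that]
    by (cases "u = \<one>\<^bsub>?A\<^esub>") (auto simp: nontrivial_units_have_order_def)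
  let ?x = "group_elem k"
  have one: "?x \<one>\<^bsub>G\<^esub> = \<one>\<^bsub>?A\<^esub>" by (rule group_elem_one)
  have inj: "?x a = ?x b \<Longrightarrow> a = b" for a b
    using k.zero_not_one by (auto simp: group_elem_def fun_eq_iff split: if_splits)
  have mult: "?x a \<otimes>\<^bsub>?A\<^esub> ?x b = ?x (a \<otimes>\<^bsub>G\<^esub> b)" "?x a \<in> carrier ?A"
    if "a \<in> carrier G" "b \<in> carrier G" for a b
    using group_elem_mult[OF k.is_cring G.is_group that] by auto
  have "?x g \<in> Units ?A"
    unfolding Units_def using g mult[of g "inv\<^bsub>G\<^esub> g"] mult[of "inv\<^bsub>G\<^esub> g" g] one by auto
  from pow[OF this] have "g [^]\<^bsub>G\<^esub> p = \<one>\<^bsub>G\<^esub>"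
    using group_elem_pow[OF k.is_cring G.is_group g(1)] one inj by metis
  moreover have "\<one>\<^bsub>k\<^esub> \<oplus>\<^bsub>k\<^esub> \<one>\<^bsub>k\<^esub> = \<zero>\<^bsub>k\<^esub>"
  proof -
    let ?m = "\<ominus>\<^bsub>?A\<^esub> \<one>\<^bsub>?A\<^esub>"
    have sq: "?m \<otimes>\<^bsub>?A\<^esub> ?m = \<one>\<^bsub>?A\<^esub>" by (simp add: A.l_minus A.r_minus)
    then have "?m \<in> Units ?A" unfolding Units_def by auto
    from pow[OF this] have p1: "?m [^]\<^bsub>?A\<^esub> p = \<one>\<^bsub>?A\<^esub>" .
    have "odd p" using \<open>prime p\<close> \<open>p > 3\<close> prime_odd_nat by auto
    then obtain j where j: "p = Suc (2 * j)" by (auto elim!: oddE)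
    have "?m [^]\<^bsub>?A\<^esub> (2::nat) = \<one>\<^bsub>?A\<^esub>"
      using sq by (simp add: numeral_2_eq_2)
    then have "?m [^]\<^bsub>?A\<^esub> (2 * j) = \<one>\<^bsub>?A\<^esub>"
      using A.nat_pow_pow[of ?m 2 j] by simp
    with p1 j have "?m = \<one>\<^bsub>?A\<^esub>" by simp
    then have "\<one>\<^bsub>?A\<^esub> \<oplus>\<^bsub>?A\<^esub> \<one>\<^bsub>?A\<^esub> = \<zero>\<^bsub>?A\<^esub>" by (metis A.l_neg A.one_closed)
    from fun_cong[OF this, of "\<one>\<^bsub>G\<^esub>"] show ?thesis by (simp add: group_algebra_def)
  qed
  ultimately interpret group_algebra_char_two k G g p
    using g assms(4,5) by unfold_locales auto
  show ?thesis
    using units A.nontrivial_units_imp_trinomial_pow A.trinomial_pow_imp_binomial_pow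
      A.binomial_pow_imp_choose_cong by blast
qed

section \<open>Circulant matrices over the field with two elements\<close>

lemma dim_circ [simp]: "dim_row (circ v) = dim_vec v" "dim_col (circ v) = dim_vec v"
  using circ_carrier[of v] by auto

lemma circ_index_if:
  assumes "i < dim_vec v" "j < dim_vec v"
  shows "circ v $$ (i, j) = v $ (if j \<le> i then i - j else i + dim_vec v - j)"
proof (cases "j \<le> i")
  case True
  then have "i + dim_vec v - j = (i - j) + dim_vec v" by simp
  then have "(i + dim_vec v - j) mod dim_vec v = (i - j) mod dim_vec v"
    by (simp only: mod_add_self2)
  also have "\<dots> = i - j" using assms by (intro mod_less) linarith
  finally have "(i + dim_vec v - j) mod dim_vec v = i - j" .
  then show ?thesis using True assms by (simp add: circ_index)
qed (use assms in \<open>simp add: circ_index\<close>)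

lemma map_mat_circ: "map_mat f (circ v) = circ (map_vec f v)"
  by (rule eq_matI) (auto simp: circ_index_if)

lemma circulant_circ:
  assumes "dim_vec v > 0"
  shows "circulant (circ v)"
proof -
  have "col (circ v) 0 = v"
    using assms by (intro eq_vecI) (auto simp: circ_index_if)
  then show ?thesis using circulant_iff[OF assms circ_carrier] by simp
qed

lemma circulant_map_mat:
  assumes "n > 0" "A \<in> carrier_mat n n" "circulant A"
  shows "circulant (map_mat f A)"
proof -
  have "A = circ (col A 0)" using circulant_iff[OF assms(1,2)] assms(3) by blast
  then have "map_mat f A = circ (map_vec f (col A 0))" by (metis map_mat_circ)
  then show ?thesis using assms by (simp add: circulant_circ)
qed

text \<open>
  The circulant matrix with first column \<open>(0, 1, 0, \<dots>, 0)\<close>; multiplying by it from the left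
  rotates the rows down by one.
\<close>

definition cyclic_shift :: "nat \<Rightarrow> bit mat" where
  "cyclic_shift n = mat n n (\<lambda>(i, j). if j = (if i = 0 then n - 1 else i - 1) then 1 else 0)"

lemma cyclic_shift_carrier [simp]: "cyclic_shift n \<in> carrier_mat n n"
  by (simp add: cyclic_shift_def)

lemma cyclic_shift_dim [simp]: "dim_row (cyclic_shift n) = n" "dim_col (cyclic_shift n) = n"
  by (simp_all add: cyclic_shift_def)

lemma cyclic_shift_mult:
  assumes "B \<in> carrier_mat n n" "i < n" "j < n"
  shows "(cyclic_shift n * B) $$ (i, j) = B $$ (if i = 0 then n - 1 else i - 1, j)"
proof -
  define i' where "i' = (if i = 0 then n - 1 else i - 1)"
  have "i' < n" using assms unfolding i'_def by (cases i) auto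
  have "(cyclic_shift n * B) $$ (i, j) = row (cyclic_shift n) i \<bullet> col B j"
    using assms by (intro index_mult_mat(1)) auto
  also have "row (cyclic_shift n) i = unit_vec n i'"
    using assms by (intro eq_vecI) (auto simp: cyclic_shift_def i'_def)
  also have "unit_vec n i' \<bullet> col B j = B $$ (i', j)"
    using assms \<open>i' < n\<close> by (subst scalar_prod_left_unit[of _ n]) auto
  finally show ?thesis by (simp only: i'_def)
qed

locale circulant_ring =
  fixes p :: nat
  assumes prime: "prime p" and gt_3: "p > 3"
begin

abbreviation "M \<equiv> ring_mat TYPE(bit) p ()"

sublocale M: ring M by (rule ring_mat)

sublocale M: char_two_evaluation M "cyclic_shift p"
proof
  show "cyclic_shift p \<in> carrier M" by (simp add: ring_mat_simps cyclic_shift_def)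
  show "\<one>\<^bsub>M\<^esub> \<oplus>\<^bsub>M\<^esub> \<one>\<^bsub>M\<^esub> = \<zero>\<^bsub>M\<^esub>" by (auto simp: ring_mat_simps)
qed

text \<open>
  Evaluating \<open>q\<close> at the cyclic shift puts the coefficients of \<open>q\<close> into the first column of a circulant
  matrix. This identifies the circulant matrices with the polynomials modulo \<open>X\<^sup>p + 1\<close>.
\<close>

lemma ev_eq_circ: "degree q < p \<Longrightarrow> M.ev q = circ (vec p (coeff q))"
proof (induction q)
  case 0 show ?case unfolding M.ev_0 ring_mat_simps
    by (rule eq_matI) (auto simp: circ_index_if)
next
  case (pCons a q)
  have "degree q < p" using pCons.prems by (auto split: if_splits)
  then have IH: "M.ev q = circ (vec p (coeff q))" by (rule pCons.IH)
  have top: "coeff q (p - 1) = 0"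
    using pCons.prems by (cases "q = 0") (auto intro!: coeff_eq_0)
  have C: "circ (vec p (coeff q)) \<in> carrier_mat p p" using circ_carrier[of "vec p (coeff q)"] by simp
  have S: "M.scalar a = a \<cdot>\<^sub>m 1\<^sub>m p" by (cases a) (auto simp: ring_mat_simps)
  have "M.ev (pCons a q) = a \<cdot>\<^sub>m 1\<^sub>m p + cyclic_shift p * circ (vec p (coeff q))"
    by (simp only: M.ev_pCons IH S ring_mat_simps)
  also have "\<dots> = circ (vec p (coeff (pCons a q)))"
  proof (rule eq_matI)
    fix i j assume "i < dim_row (circ (vec p (coeff (pCons a q))))" "j < dim_col (circ (vec p (coeff (pCons a q))))"
    then have ij: "i < p" "j < p" by (auto simp: circ_def)
    have "(a \<cdot>\<^sub>m 1\<^sub>m p + cyclic_shift p * circ (vec p (coeff q))) $$ (i, j)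
       = (if i = j then a else 0) + circ (vec p (coeff q)) $$ (if i = 0 then p - 1 else i - 1, j)"
    proof -
      have "(a \<cdot>\<^sub>m 1\<^sub>m p + cyclic_shift p * circ (vec p (coeff q))) $$ (i, j)
        = (a \<cdot>\<^sub>m 1\<^sub>m p) $$ (i, j) + (cyclic_shift p * circ (vec p (coeff q))) $$ (i, j)"
        using ij by (intro index_add_mat(1)) simp_all
      also have "(a \<cdot>\<^sub>m 1\<^sub>m p) $$ (i, j) = (if i = j then a else 0)" using ij by simp
      finally show ?thesis by (simp only: cyclic_shift_mult[OF C ij])
    qed
    also have "\<dots> = circ (vec p (coeff (pCons a q))) $$ (i, j)"
    proof -
      define i' where "i' = (if i = 0 then p - 1 else i - 1)"
      define d where "d = (if j \<le> i then i - j else i + p - j)"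
      define d' where "d' = (if j \<le> i' then i' - j else i' + p - j)"
      have "i' < p" unfolding i'_def using ij by (cases i) auto
      then have c: "circ (vec p (coeff q)) $$ (i', j) = coeff q d'"
        and c': "circ (vec p (coeff (pCons a q))) $$ (i, j) = coeff (pCons a q) d"
        using ij by (auto simp: circ_index_if d_def d'_def)
      show ?thesis
      \<comment> \<open>The coefficient of index \<open>d\<close> after the shift is that of index \<open>d' = d - 1\<close> before it, cyclically:
        on the diagonal \<open>d'\<close> wraps around to \<open>p - 1\<close>.\<close>
      proof (cases "i = j")
        case True
        then have "d = 0" "d' = p - 1" using ij unfolding d_def d'_def i'_def by (auto split: if_splits)
        then show ?thesis using True top c c' unfolding i'_def[symmetric] by simp
      next
        case False
        have "d = Suc d'"
        proof (cases i)
          case 0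
          moreover have "j \<le> p - 1" using ij by linarith
          ultimately show ?thesis
            using False ij unfolding d_def d'_def i'_def by (simp add: Suc_diff_Suc)
        next
          case (Suc l)
          then show ?thesis using False ij unfolding d_def d'_def i'_def
            by (cases "j \<le> l") (simp_all add: Suc_diff_le)
        qed
        then show ?thesis using False c c' unfolding i'_def[symmetric] by simp
      qed
    qed
    finally show "(a \<cdot>\<^sub>m 1\<^sub>m p + cyclic_shift p * circ (vec p (coeff q))) $$ (i, j)
       = circ (vec p (coeff (pCons a q))) $$ (i, j)" .
  qed (use C in \<open>auto simp: circ_def cyclic_shift_def\<close>)
  finally show ?case .
qed

sublocale M: cyclic_evaluation M "cyclic_shift p" p
proof
  show "cyclic_shift p [^]\<^bsub>M\<^esub> p = \<one>\<^bsub>M\<^esub>"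
  proof -
    have m: "bX ^ (p - 1) = monom 1 (p - 1)" by (simp add: monom_altdef)
    have "degree (bX ^ (p - 1)) < p" unfolding m using gt_3 by (simp add: degree_monom_eq)
    from ev_eq_circ[OF this] have "M.ev (bX ^ (p - 1)) = circ (vec p (coeff (bX ^ (p - 1))))" .
    also have "vec p (coeff (bX ^ (p - 1))) = vec p (\<lambda>i. if i = p - 1 then 1 else 0)"
      unfolding m by (intro eq_vecI) auto
    finally have e: "M.ev (bX ^ (p - 1)) = circ (vec p (\<lambda>i. if i = p - 1 then 1 else 0))" .
    have "cyclic_shift p [^]\<^bsub>M\<^esub> Suc (p - 1) = cyclic_shift p \<otimes>\<^bsub>M\<^esub> M.ev (bX ^ (p - 1))"
      using M.nat_pow_Suc2[OF M.x, of "p - 1"] by (simp only: M.ev_power M.ev_bX)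
    also have "\<dots> = \<one>\<^bsub>M\<^esub>" unfolding e ring_mat_simps
    proof (rule eq_matI)
      fix i j assume "i < dim_row (1\<^sub>m p)" "j < dim_col (1\<^sub>m p)"
      then have ij: "i < p" "j < p" by simp_all
      let ?w = "vec p (\<lambda>i. if i = p - 1 then 1 else (0::bit))"
      define i' where "i' = (if i = 0 then p - 1 else i - 1)"
      have i': "i' < p" unfolding i'_def using ij by (cases i) auto
      have "circ ?w \<in> carrier_mat p p" using circ_carrier[of ?w] by simp
      from cyclic_shift_mult[OF this ij]
      have "(cyclic_shift p * circ ?w) $$ (i, j) = circ ?w $$ (i', j)" by (simp only: i'_def)
      also have "\<dots> = ?w $ (if j \<le> i' then i' - j else i' + p - j)"
        using i' ij by (simp only: circ_index_if dim_vec)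
      also have "\<dots> = (if i = j then 1 else 0)"
        using i' ij unfolding i'_def by (cases i) auto
      finally show "(cyclic_shift p * circ ?w) $$ (i, j) = 1\<^sub>m p $$ (i, j)" using ij by simp
    qed simp_all
    finally show ?thesis using gt_3 by simp
  qed
  fix q assume q: "degree q < p" "M.ev q = \<zero>\<^bsub>M\<^esub>"
  have "coeff q r = 0" for r
  proof (cases "r < p")
    case True
    then have "circ (vec p (coeff q)) $$ (r, 0) = 0" using q by (simp add: ev_eq_circ ring_mat_simps)
    then show ?thesis using True by (simp add: circ_index_if)
  qed (use q in \<open>auto intro: coeff_eq_0\<close>)
  then show "q = 0" by (simp add: poly_eq_iff)
qed (fact prime gt_3)+

lemma circ_vec_of_list:
  assumes "length bs = p"
  shows "circ (vec_of_list bs) = M.ev (Poly bs)"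
proof -
  have "degree (Poly bs) < p" using gt_3 assms by (intro degree_lessI) (auto simp: nth_default_def)
  then have "M.ev (Poly bs) = circ (vec p (coeff (Poly bs)))" by (rule ev_eq_circ)
  also have "vec p (coeff (Poly bs)) = vec_of_list bs"
    using assms by (intro eq_vecI) (auto simp: nth_default_def vec_of_list_index)
  finally show ?thesis by simp
qed

lemma circulant_iff_ev: "A \<in> carrier M \<and> circulant A \<longleftrightarrow> A \<in> range M.ev"
proof
  assume A: "A \<in> carrier M \<and> circulant A"
  then have C: "A \<in> carrier_mat p p" by (simp add: ring_mat_simps)
  then have "A = circ (vec_of_list (list_of_vec (col A 0)))"
    using A gt_3 circulant_iff[of p A] by (simp add: vec_list)
  also have "\<dots> = M.ev (Poly (list_of_vec (col A 0)))" using C by (intro circ_vec_of_list) simp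
  finally show "A \<in> range M.ev" by blast
next
  assume "A \<in> range M.ev"
  then obtain q where "A = M.ev q" by blast
  then obtain r where r: "degree r < p" "A = M.ev r" using M.ev_reduce by metis
  then have "circulant A" using gt_3 by (simp add: ev_eq_circ circulant_circ)
  then show "A \<in> carrier M \<and> circulant A" using r by simp
qed

lemma trinomial_circ: "circ (vec_of_list ([1, 1, 1] @ replicate (p - 3) 0)) = M.ev [:1, 1, 1:]"
  and binomial_circ: "circ (vec_of_list ([1, 1] @ replicate (p - 2) 0)) = M.ev [:1, 1:]"
  and binomial_cube_circ: "circ (vec_of_list ([1, 0, 0, 1] @ replicate (p - 4) 0)) = M.ev [:1, 0, 0, 1:]"
  using gt_3 by (subst circ_vec_of_list; simp)+

abbreviation "K \<equiv> circulant_unit_group TYPE(bit) p"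

lemma K_simps:
  "carrier K = Units M \<inter> range M.ev" "(\<otimes>\<^bsub>K\<^esub>) = (\<otimes>\<^bsub>M\<^esub>)" "\<one>\<^bsub>K\<^esub> = \<one>\<^bsub>M\<^esub>"
  "A [^]\<^bsub>K\<^esub> (n::nat) = A [^]\<^bsub>M\<^esub> n"
  using circulant_iff_ev M.Units_closed
  by (auto simp: circulant_unit_group_def units_of_def nat_pow_def)

text \<open>
  Circulant matrices commute, being polynomials in one matrix, and \<open>A\<^bsup>p-1\<^esup>\<close> is a circulant inverse of a
  circulant unit \<open>A\<close>.
\<close>

lemma mersenne_imp_elementary_abelian:
  assumes "mersenne_prime p"
  shows "elementary_abelian p K"
proof -
  obtain n where n: "p = 2 ^ n - 1" using assms by (auto simp: mersenne_prime_def)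
  have pow: "A [^]\<^bsub>M\<^esub> p = \<one>\<^bsub>M\<^esub>" if "A \<in> carrier K" for A
    using that M.unit_pow_mersenne[OF n] by (auto simp: K_simps)
  have comm: "comm_group K"
  proof (rule comm_groupI)
    fix A assume A: "A \<in> carrier K"
    then obtain q where q: "A = M.ev q" by (auto simp: K_simps)
    have "A [^]\<^bsub>M\<^esub> (p - 1) \<otimes>\<^bsub>M\<^esub> A = \<one>\<^bsub>M\<^esub>"
      using pow[OF A] gt_3 by (cases p) auto
    moreover have "A [^]\<^bsub>M\<^esub> (p - 1) \<in> range M.ev" unfolding q M.ev_power[symmetric] by simp
    then have "A [^]\<^bsub>M\<^esub> (p - 1) \<in> carrier K" using A by (simp add: K_simps M.Units_pow_closed)
    ultimately show "\<exists>B\<in>carrier K. B \<otimes>\<^bsub>K\<^esub> A = \<one>\<^bsub>K\<^esub>" by (auto simp: K_simps)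
  next
    have "\<one>\<^bsub>M\<^esub> \<in> range M.ev" by (metis M.ev_1 rangeI)
    then show "\<one>\<^bsub>K\<^esub> \<in> carrier K" by (simp add: K_simps)
  qed (auto simp: K_simps M.ev_mult[symmetric] ac_simps simp del: M.ev_closed)
  then interpret K: comm_group K .
  have "K.ord A = p" if "A \<in> carrier K" "A \<noteq> \<one>\<^bsub>K\<^esub>" for A
    using that pow K.ord_prime_iff[OF prime that] by (simp add: K_simps)
  then show ?thesis using comm prime by (simp add: elementary_abelian_def)
qed

lemma elementary_abelian_imp_trinomial_pow:
  assumes "elementary_abelian p K"
  shows "M.ev [:1, 1, 1:] [^]\<^bsub>M\<^esub> p = \<one>\<^bsub>M\<^esub>"
proof (cases "M.ev [:1, 1, 1:] = \<one>\<^bsub>M\<^esub>")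
  case False
  interpret K: comm_group K using assms by (simp add: elementary_abelian_def)
  have A: "M.ev [:1, 1, 1:] \<in> carrier K" using M.trinomial_Units by (simp add: K_simps)
  then have "K.ord (M.ev [:1, 1, 1:]) = p" using False assms by (simp add: elementary_abelian_def K_simps)
  then show ?thesis using K.pow_ord_eq_1[OF A] by (simp add: K_simps)
qed simp

text \<open>
  The order is exactly \<open>p\<close> since the trinomial is a unit and, by independence, differs from \<open>1\<close>.
\<close>

lemma trinomial_ord_iff:
  "M.ev [:1, 1, 1:] \<in> Units M \<and> group.ord (units_of M) (M.ev [:1, 1, 1:]) = p
    \<longleftrightarrow> M.ev [:1, 1, 1:] [^]\<^bsub>M\<^esub> p = \<one>\<^bsub>M\<^esub>"
proof -
  have "M.ev [:1, 1, 1:] \<noteq> \<one>\<^bsub>M\<^esub>"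
  proof
    assume "M.ev [:1, 1, 1:] = \<one>\<^bsub>M\<^esub>"
    then have "M.ev ([:1, 1, 1:] + 1) = \<zero>\<^bsub>M\<^esub>" using M.char_two by (simp only: M.ev_add M.ev_1)
    then show False using M.independent[of "[:1, 1, 1:] + 1"] gt_3 by (simp add: one_pCons)
  qed
  then show ?thesis using M.trinomial_Units M.ord_units_prime_iff[OF prime] by blast
qed

end

section \<open>Perfect matchings and pseudopaths modulo two\<close>

definition biadjacency_bit :: "nat \<Rightarrow> (nat \<times> nat) set \<Rightarrow> bit mat" where
  "biadjacency_bit n E = map_mat of_int (biadjacency n E)"

lemma of_nat_bit: "(of_nat n :: bit) = of_bool (odd n)"
  by (induction n) auto

lemma pseudopaths_parity_iff:
  assumes "bipartite_graph n E" "n > 0" "r > 0"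
  shows "(\<forall>i<n. \<forall>j<n. num_pseudopaths E r i j mod 2 = (if i = j then 1 else 0)) \<longleftrightarrow>
    biadjacency_bit n E [^]\<^bsub>ring_mat TYPE(bit) n ()\<^esub> r = \<one>\<^bsub>ring_mat TYPE(bit) n ()\<^esub>"
proof -
  have B: "biadjacency n E \<in> carrier_mat n n" by (simp add: biadjacency_def)
  then have b: "biadjacency_bit n E \<in> carrier_mat n n" by (simp add: biadjacency_bit_def)
  have "(biadjacency_bit n E ^\<^sub>m r) $$ (i, j) = of_nat (num_pseudopaths E r i j)" if "i < n" "j < n" for i j
  proof -
    have "biadjacency_bit n E ^\<^sub>m r = map_mat of_int (biadjacency n E ^\<^sub>m r)"
      unfolding biadjacency_bit_def using B by (simp add: of_int_hom.mat_hom_pow)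
    then show ?thesis
      using that pow_carrier_mat[OF B, of r] num_pseudopaths_mat[OF assms(1,3) that] by (metis carrier_matD index_map_mat(1) of_int_of_nat_eq)
  qed
  then have "biadjacency_bit n E ^\<^sub>m r = 1\<^sub>m n \<longleftrightarrow>
      (\<forall>i<n. \<forall>j<n. of_nat (num_pseudopaths E r i j) = (if i = j then 1 else (0::bit)))"
    using pow_carrier_mat[OF b, of r] by (auto simp: mat_eq_iff)
  also have "\<dots> \<longleftrightarrow> (\<forall>i<n. \<forall>j<n. num_pseudopaths E r i j mod 2 = (if i = j then 1 else 0))"
    by (intro all_cong1 imp_cong refl) (auto simp: mod_2_eq_odd of_nat_bit)
  finally show ?thesis unfolding pow_mat_ring_pow[OF b, of r "()"] ring_mat_simps by (rule sym)
qed

text \<open>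
  A perfect matching is the graph of a permutation. Permutations fix all numbers from \<open>n\<close> on, so
  they are determined by their graphs over \<open>{0..<n}\<close>.
\<close>

lemma perfect_matchings_permutations:
  assumes "bipartite_graph n E"
  shows "bij_betw (\<lambda>\<pi>. (\<lambda>i. (i, \<pi> i)) ` {0..<n})
    {\<pi>. \<pi> permutes {0..<n} \<and> (\<forall>i<n. (i, \<pi> i) \<in> E)} {S. perfect_matching n E S}"
    (is "bij_betw ?f ?P ?S")
  unfolding bij_betw_def
proof (intro conjI inj_onI equalityI subsetI)
  fix \<pi> \<sigma> assume a: "\<pi> \<in> ?P" "\<sigma> \<in> ?P" "?f \<pi> = ?f \<sigma>"
  show "\<pi> = \<sigma>"
  proof
    fix i show "\<pi> i = \<sigma> i"
    proof (cases "i < n")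
      case True
      then have "(i, \<pi> i) \<in> ?f \<sigma>" using a(3) by (metis (no_types, lifting) atLeast0LessThan image_eqI lessThan_iff)
      then show ?thesis by auto
    qed (use a in \<open>auto simp: permutes_def\<close>)
  qed
next
  fix S assume "S \<in> ?f ` ?P"
  then obtain \<pi> where pi: "\<pi> permutes {0..<n}" "\<forall>i<n. (i, \<pi> i) \<in> E" and S: "S = ?f \<pi>" by blast
  have "\<exists>!e. e \<in> S \<and> fst e = i" if "i < n" for i using that unfolding S by (intro ex1I[of _ "(i, \<pi> i)"]) auto
  moreover have "\<exists>!e. e \<in> S \<and> snd e = j" if "j < n" for j
  proof (rule ex1I[of _ "(inv_into UNIV \<pi> j, j)"])
    have "inv_into UNIV \<pi> j < n" using permutes_in_image[OF permutes_inv[OF pi(1)], of j] that by simp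
    then show "(inv_into UNIV \<pi> j, j) \<in> S \<and> snd (inv_into UNIV \<pi> j, j) = j"
      unfolding S using permutes_inverses(1)[OF pi(1), of j] by (auto simp: image_iff)
    show "e = (inv_into UNIV \<pi> j, j)" if "e \<in> S \<and> snd e = j" for e
      using that permutes_inverses(2)[OF pi(1)] unfolding S by auto
  qed
  ultimately show "S \<in> ?S" using pi(2) unfolding perfect_matching_def S by auto
next
  fix S assume "S \<in> ?S"
  then have S: "S \<subseteq> E" "\<And>i. i < n \<Longrightarrow> \<exists>!e. e \<in> S \<and> fst e = i" "\<And>j. j < n \<Longrightarrow> \<exists>!e. e \<in> S \<and> snd e = j"
    unfolding perfect_matching_def by auto
  have lt: "i < n \<and> j < n" if "(i, j) \<in> S" for i j
    using that S(1) assms unfolding bipartite_graph_def by auto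
  define \<pi> where "\<pi> i = (if i < n then snd (THE e. e \<in> S \<and> fst e = i) else i)" for i
  have pi: "(i, \<pi> i) \<in> S" if "i < n" for i
    using theI'[OF S(2)[OF that]] that by (simp add: \<pi>_def) (metis prod.collapse)
  have pi_eq: "j = \<pi> i" if "(i, j) \<in> S" for i j
    using that lt[OF that] S(2)[of i] pi[of i] by (metis fst_conv snd_conv)
  have "inj_on \<pi> {0..<n}"
  proof (rule inj_onI)
    fix i i' assume "i \<in> {0..<n}" "i' \<in> {0..<n}" "\<pi> i = \<pi> i'"
    then show "i = i'" using pi[of i] pi[of i'] S(3)[of "\<pi> i"] lt[of i "\<pi> i"] by (metis atLeastLessThan_iff fst_conv snd_conv)
  qed
  moreover have "\<pi> ` {0..<n} \<subseteq> {0..<n}" using lt[OF pi] by auto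
  ultimately have "bij_betw \<pi> {0..<n} {0..<n}"
    by (simp add: bij_betw_def endo_inj_surj)
  then have "\<pi> permutes {0..<n}" by (rule bij_imp_permutes) (simp add: \<pi>_def)
  moreover have "S = ?f \<pi>" using pi pi_eq lt by (auto simp: image_iff)
  ultimately show "S \<in> ?f ` ?P" using pi S(1) by blast
qed

text \<open>
  Modulo two the signs in the Leibniz formula disappear and the determinant becomes the permanent, in
  which each permutation contributes \<open>1\<close> exactly if its graph consists of edges.
\<close>

lemma det_biadjacency_bit:
  assumes "bipartite_graph n E"
  shows "det (biadjacency_bit n E) = of_nat (card {S. perfect_matching n E S})"
proof -
  let ?Q = "{\<pi>. \<pi> permutes {0..<n}}" and ?P = "{\<pi>. \<pi> permutes {0..<n} \<and> (\<forall>i<n. (i, \<pi> i) \<in> E)}"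
  have b: "biadjacency_bit n E \<in> carrier_mat n n" by (simp add: biadjacency_bit_def biadjacency_def)
  have "signof \<pi> = (1::bit)" for \<pi> :: "nat \<Rightarrow> nat" by (simp add: sign_def)
  moreover have "(\<Prod>i = 0..<n. biadjacency_bit n E $$ (i, \<pi> i)) = (if \<forall>i<n. (i, \<pi> i) \<in> E then 1 else 0)"
    if "\<pi> permutes {0..<n}" for \<pi>
  proof -
    have "\<pi> i < n" if "i < n" for i using permutes_in_image[OF \<open>\<pi> permutes {0..<n}\<close>, of i] that by simp
    then have "(\<Prod>i = 0..<n. biadjacency_bit n E $$ (i, \<pi> i)) = (\<Prod>i = 0..<n. if (i, \<pi> i) \<in> E then 1 else 0)"
      by (intro prod.cong) (auto simp: biadjacency_bit_def biadjacency_def)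
    then show ?thesis by (auto intro!: prod.neutral)
  qed
  ultimately have "det (biadjacency_bit n E) = (\<Sum>\<pi>\<in>?Q. if \<forall>i<n. (i, \<pi> i) \<in> E then 1 else 0)"
    unfolding det_def'[OF b] by (intro sum.cong) auto
  also have "\<dots> = (\<Sum>\<pi>\<in>?P. 1)"
    by (rule sum.mono_neutral_cong_right) (auto simp: finite_permutations)
  also have "\<dots> = of_nat (card {S. perfect_matching n E S})"
    using bij_betw_same_card[OF perfect_matchings_permutations[OF assms]] by simp
  finally show ?thesis .
qed

section \<open>Copies of finite structures in infinite types\<close>

text \<open>
  The cyclic group and the field with two elements are carried along such injections into arbitrary
  infinite types.
\<close>

lemma exists_inj_on_infinite:
  assumes "finite A"
  shows "\<exists>h :: 'a \<Rightarrow> 'b::infinite. inj_on h A"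
proof -
  obtain B :: "'b set" where "finite B" "card B = card A"
    using infinite_arbitrarily_large[OF infinite_UNIV] by metis
  then obtain h where "bij_betw h A B" using finite_same_card_bij[OF assms] by metis
  then show ?thesis by (auto simp: bij_betw_def)
qed

lemma group_copy:
  assumes "group C" "inj_on h (carrier C)"
  defines "H \<equiv> \<lparr>carrier = h ` carrier C,
    monoid.mult = \<lambda>a b. h (inv_into (carrier C) h a \<otimes>\<^bsub>C\<^esub> inv_into (carrier C) h b), one = h \<one>\<^bsub>C\<^esub>\<rparr>"
  shows "group H" "h \<in> hom C H"
proof -
  interpret C: group C by fact
  show hom: "h \<in> hom C H" using assms(2) by (auto simp: hom_def H_def)
  have "H\<lparr>carrier := h ` carrier C, one := h \<one>\<^bsub>C\<^esub>\<rparr> = H" by (simp add: H_def)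
  then show "group H" using C.hom_imp_img_group[OF hom] by simp
qed

lemma UNIV_bit: "(UNIV :: bit set) = {0, 1}"
  using bit.exhaust by auto

lemma field_with_two_elements_copy:
  fixes h :: "bit \<Rightarrow> 'a"
  assumes "inj h"
  defines "k \<equiv> \<lparr>carrier = range h, monoid.mult = \<lambda>a b. h (inv_into UNIV h a * inv_into UNIV h b), one = h 1,
    zero = h 0, add = \<lambda>a b. h (inv_into UNIV h a + inv_into UNIV h b)\<rparr>"
  shows "field k" "carrier k = {\<zero>\<^bsub>k\<^esub>, \<one>\<^bsub>k\<^esub>}" "\<one>\<^bsub>k\<^esub> \<oplus>\<^bsub>k\<^esub> \<one>\<^bsub>k\<^esub> = \<zero>\<^bsub>k\<^esub>"
proof -
  have "h \<in> ring_iso F2 k"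
    using assms(1) by (auto simp: ring_iso_def Ring.ring_hom_def F2_def k_def bij_betw_def)
  from field.ring_iso_imp_img_field[OF field_F2 this] show "field k" by (simp add: F2_def k_def)
  show "carrier k = {\<zero>\<^bsub>k\<^esub>, \<one>\<^bsub>k\<^esub>}" by (simp add: k_def UNIV_bit)
  show "\<one>\<^bsub>k\<^esub> \<oplus>\<^bsub>k\<^esub> \<one>\<^bsub>k\<^esub> = \<zero>\<^bsub>k\<^esub>" using assms(1) by (simp add: k_def)
qed

lemma cyclic_group_generator:
  assumes "group C" "order C = p" "p > 1" "x \<in> carrier C" "generate C {x} = carrier C"
  shows "finite (carrier C)" "x \<noteq> \<one>\<^bsub>C\<^esub>" "x [^]\<^bsub>C\<^esub> p = \<one>\<^bsub>C\<^esub>"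
    "carrier C = range (\<lambda>n::nat. x [^]\<^bsub>C\<^esub> n)"
proof -
  interpret C: group C by fact
  show fin: "finite (carrier C)" using assms(2,3) card_gt_0_iff[of "carrier C"] by (simp add: Coset.order_def)
  show "x [^]\<^bsub>C\<^esub> p = \<one>\<^bsub>C\<^esub>" using C.pow_order_eq_1[OF assms(4)] assms(2) by simp
  show "carrier C = range (\<lambda>n::nat. x [^]\<^bsub>C\<^esub> n)"
    using C.generate_pow_on_finite_carrier[OF fin assms(4)] assms(5) by auto
  have "carrier C = {\<one>\<^bsub>C\<^esub>}" if "x = \<one>\<^bsub>C\<^esub>" using that assms(5) C.generate_one by metis
  then show "x \<noteq> \<one>\<^bsub>C\<^esub>" using assms(2,3) by (auto simp: Coset.order_def)
qed

lemma mersenne_imp_units_in_infinite_types: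
  fixes C :: "'c monoid"
  assumes "mersenne_prime p" "p > 3" "group C" "order C = p" "x \<in> carrier C" "generate C {x} = carrier C"
  shows "\<exists>(G :: ('g::infinite) monoid) (k :: ('k::infinite) ring).
      comm_group G \<and> \<not> trivial_group G \<and> field k \<and>
      nontrivial_units_have_order (group_algebra k G) p"
proof -
  note gen = cyclic_group_generator[OF assms(3,4) _ assms(5,6)]
  have p: "prime p" "p > 1" using assms(1,2) by (auto simp: mersenne_prime_def)
  interpret C: group C by fact
  obtain h :: "'c \<Rightarrow> 'g" where h: "inj_on h (carrier C)" using exists_inj_on_infinite gen(1) p(2) by blast
  define H where "H = \<lparr>carrier = h ` carrier C,
    monoid.mult = \<lambda>a b. h (inv_into (carrier C) h a \<otimes>\<^bsub>C\<^esub> inv_into (carrier C) h b), one = h \<one>\<^bsub>C\<^esub>\<rparr>"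
  have H: "group H" "h \<in> hom C H" using group_copy[OF assms(3) h] by (simp_all add: H_def)
  obtain c :: "bit \<Rightarrow> 'k" where c: "inj c"
    using exists_inj_on_infinite[of "UNIV :: bit set"] by (auto simp: UNIV_bit)
  define k where "k = \<lparr>carrier = range c, monoid.mult = \<lambda>a b. c (inv_into UNIV c a * inv_into UNIV c b), one = c 1,
    zero = c 0, add = \<lambda>a b. c (inv_into UNIV c a + inv_into UNIV c b)\<rparr>"
  note k = field_with_two_elements_copy[OF c, folded k_def]
  have pow: "h (x [^]\<^bsub>C\<^esub> n) = h x [^]\<^bsub>H\<^esub> n" for n :: nat
    using hom_nat_pow[OF H(2) assms(5,3) H(1)] .
  have one: "\<one>\<^bsub>H\<^esub> = h \<one>\<^bsub>C\<^esub>" by (simp add: H_def)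
  have ne: "h x \<noteq> \<one>\<^bsub>H\<^esub>" using gen(2)[OF p(2)] inj_on_eq_iff[OF h assms(5), of "\<one>\<^bsub>C\<^esub>"] one by simp
  have hx: "h x \<in> carrier H" using assms(5) by (simp add: H_def)
  have car: "carrier H = range (\<lambda>n::nat. h x [^]\<^bsub>H\<^esub> n)"
  proof -
    have "carrier H = h ` carrier C" by (simp add: H_def)
    then show ?thesis unfolding gen(4)[OF p(2)] image_image pow .
  qed
  interpret H: group H by fact
  have "comm_group H"
    by (rule H.group_comm_groupI) (auto simp: car intro: H.nat_pow_comm[OF hx])
  moreover have "\<not> trivial_group H" using ne hx by (auto simp: trivial_group_def)
  moreover interpret group_algebra_char_two k H "h x" p
    using k(1,3) H(1) hx ne pow[of p] gen(3)[OF p(2)] one p(1) assms(2)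
    by (auto simp: group_algebra_char_two_def group_algebra_char_two_axioms_def)
  have "nontrivial_units_have_order (group_algebra k H) p"
    using mersenne_imp_units[OF assms(1) k(2) car] .
  ultimately show ?thesis using k(1) by blast
qed

section \<open>Circulant graphs\<close>

context circulant_ring
begin

abbreviation "trinomial_graph \<equiv> graph_of_mat (circ (vec_of_list ([1, 1, 1] @ replicate (p - 3) 0)))"

text \<open>
  The entries of the integer matrix are \<open>0\<close> and \<open>1\<close>, so passing to the graph and back loses nothing, and
  reduction modulo two gives the circulant matrix of \<open>1 + X + X\<^sup>2\<close>.
\<close>

lemma trinomial_graph:
  "bipartite_graph p trinomial_graph" "circulant (biadjacency p trinomial_graph)"
  "biadjacency_bit p trinomial_graph = M.ev [:1, 1, 1:]"
proof -
  define l :: "int list" where "l = [1, 1, 1] @ replicate (p - 3) 0"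
  have l: "length l = p" "set l \<subseteq> {0, 1}" using gt_3 by (auto simp: l_def)
  have "vec_of_list l $ i \<in> {0, 1}" if "i < p" for i

    using subsetD[OF l(2) nth_mem[of i l]] that l(1) by (simp add: vec_of_list_index)
  then have "circ (vec_of_list l) $$ (i, j) \<in> {0, 1}" if "i < p" "j < p" for i j
    using that l(1) by (subst circ_index) auto
  then have e: "biadjacency p (graph_of_mat (circ (vec_of_list l))) = circ (vec_of_list l)"
    using l(1) by (intro eq_matI) (auto simp: biadjacency_def graph_of_mat_def)
  show "bipartite_graph p trinomial_graph"
    unfolding l_def[symmetric] using l(1) by (auto simp: bipartite_graph_def graph_of_mat_def)
  show "circulant (biadjacency p trinomial_graph)"
    unfolding l_def[symmetric] e using l(1) gt_3 by (intro circulant_circ) simp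
  have "map of_int l = [1, 1, 1] @ replicate (p - 3) (0 :: bit)" by (simp add: l_def)
  then show "biadjacency_bit p trinomial_graph = M.ev [:1, 1, 1:]"
    unfolding l_def[symmetric] biadjacency_bit_def e map_mat_circ
    by (simp only: vec_of_list_map[symmetric] trinomial_circ)
qed

lemma odd_matchings_trinomial_graph: "odd (card {S. perfect_matching p trinomial_graph S})"
  using det_biadjacency_bit[OF trinomial_graph(1)] unit_imp_det_non_zero[OF M.trinomial_Units]
  unfolding trinomial_graph(3) of_nat_bit by (metis of_bool_eq(1))

text \<open>
  An odd number of perfect matchings means that the biadjacency matrix is invertible modulo two; as a
  circulant unit it then has \<open>p\<close>-th power \<open>1\<close>.
\<close>

lemma pseudopaths_if_mersenne:
  assumes "mersenne_prime p" "bipartite_graph p E" "circulant (biadjacency p E)"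
    and "odd (card {S. perfect_matching p E S})" "i < p" "j < p"
  shows "num_pseudopaths E p i j mod 2 = (if i = j then 1 else 0)"
proof -
  obtain n where n: "p = 2 ^ n - 1" using assms(1) by (auto simp: mersenne_prime_def)
  let ?B = "biadjacency_bit p E"
  have B: "?B \<in> carrier_mat p p" by (simp add: biadjacency_bit_def biadjacency_def)
  have "circulant ?B" unfolding biadjacency_bit_def
    using gt_3 assms(3) by (intro circulant_map_mat[of p]) (auto simp: biadjacency_def)
  then obtain q where q: "?B = M.ev q" using B circulant_iff_ev[of ?B] by (auto simp: ring_mat_simps)
  have "det ?B \<noteq> 0" using det_biadjacency_bit[OF assms(2)] assms(4) by (simp add: of_nat_bit)
  then have "?B \<in> Units M" using B by (intro det_non_zero_imp_unit)
  then have "?B [^]\<^bsub>M\<^esub> p = \<one>\<^bsub>M\<^esub>" using M.unit_pow_mersenne[OF n] q by simp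
  then show ?thesis using pseudopaths_parity_iff[OF assms(2), of p] gt_3 assms(5,6) by simp
qed

end

section \<open>The equivalences\<close>

text \<open>
  All implications run from the first statement to the seventh, along four routes, and the seventh
  closes the cycle.
\<close>

lemma all_equivalent_by_cycles:
  assumes "P1 \<Longrightarrow> P2" "P2 \<Longrightarrow> P3" "P3 \<Longrightarrow> P7" "P7 \<Longrightarrow> P1"
    and "P1 \<Longrightarrow> P4" "P4 \<Longrightarrow> P5" "P5 \<Longrightarrow> P6" "P6 \<Longrightarrow> P7"
    and "P1 \<Longrightarrow> P8" "P8 \<Longrightarrow> P9" "P9 \<Longrightarrow> P10" "P10 \<Longrightarrow> P7"
    and "P1 \<Longrightarrow> P11" "P11 \<Longrightarrow> P12" "P12 \<Longrightarrow> P9"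
  shows "all_equivalent [P1, P2, P3, P4, P5, P6, P7, P8, P9, P10, P11, P12]"
proof -
  have "P2 = P1" "P3 = P1" "P4 = P1" "P5 = P1" "P6 = P1" "P7 = P1" "P8 = P1" "P9 = P1"
    "P10 = P1" "P11 = P1" "P12 = P1"
    using assms by blast+
  then show ?thesis by (simp add: all_equivalent_def)
qed

theorem theorem1p1:
  fixes p :: nat and C :: "'c monoid" and x :: 'c
  assumes "prime p" and "p > 3"
    and "group C" and "order C = p"
    and "x \<in> carrier C" and "generate C {x} = carrier C"
  defines "R \<equiv> group_algebra F2 C"
    and "X \<equiv> group_elem F2 x"
    and "M \<equiv> ring_mat TYPE(bit) p ()"
  shows "all_equivalent [
    mersenne_prime p,
    \<exists>(G :: ('g::infinite) monoid) (k :: ('k::infinite) ring).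
      comm_group G \<and> \<not> trivial_group G \<and> field k \<and>
      nontrivial_units_have_order (group_algebra k G) p,
    \<exists>(G :: 'g monoid) (k :: 'k ring).
      group G \<and> \<not> trivial_group G \<and> field k \<and>
      nontrivial_units_have_order (group_algebra k G) p,
    nontrivial_units_have_order R p,
    (\<one>\<^bsub>R\<^esub> \<oplus>\<^bsub>R\<^esub> X \<oplus>\<^bsub>R\<^esub> X [^]\<^bsub>R\<^esub> (2::nat)) [^]\<^bsub>R\<^esub> p = \<one>\<^bsub>R\<^esub>,
    (\<one>\<^bsub>R\<^esub> \<oplus>\<^bsub>R\<^esub> X) [^]\<^bsub>R\<^esub> p = (\<one>\<^bsub>R\<^esub> \<oplus>\<^bsub>R\<^esub> X [^]\<^bsub>R\<^esub> (3::nat)) [^]\<^bsub>R\<^esub> p,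
    \<forall>r\<in>{1..p - 1}. [p choose r = p choose (3 * r mod p)] (mod 2),
    elementary_abelian p (circulant_unit_group TYPE(bit) p),
    circ (vec_of_list ([1, 1, 1] @ replicate (p - 3) 0)) \<in> Units M \<and>
      group.ord (units_of M) (circ (vec_of_list ([1, 1, 1] @ replicate (p - 3) 0))) = p,
    circ (vec_of_list ([1, 1] @ replicate (p - 2) 0)) [^]\<^bsub>M\<^esub> p =
      circ (vec_of_list ([1, 0, 0, 1] @ replicate (p - 4) 0)) [^]\<^bsub>M\<^esub> p,
    \<forall>E. bipartite_graph p E \<and> circulant (biadjacency p E) \<and> odd (card {S. perfect_matching p E S})
      \<longrightarrow> (\<forall>i<p. \<forall>j<p. num_pseudopaths E p i j mod 2 = (if i = j then 1 else 0)),
    \<forall>i<p. \<forall>j<p.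
      num_pseudopaths (graph_of_mat (circ (vec_of_list ([1, 1, 1] @ replicate (p - 3) 0)))) p i j mod 2
        = (if i = j then 1 else 0)]"
    (is "all_equivalent [?P1, ?P2, ?P3, ?P4, ?P5, ?P6, ?P7, ?P8, ?P9, ?P10, ?P11, ?P12]")
proof -
  have p: "p > 1" using assms(2) by simp
  note gen = cyclic_group_generator[OF assms(3,4) p assms(5,6)]
  interpret GA: group_algebra_char_two F2 C x p
    using assms(1-3,5) gen field_F2
    by (auto simp: group_algebra_char_two_def group_algebra_char_two_axioms_def F2_def)
  interpret CR: circulant_ring p by unfold_locales (fact assms)+
  show ?thesis
  proof (rule all_equivalent_by_cycles)
    show "?P1 \<Longrightarrow> ?P2"
      using mersenne_imp_units_in_infinite_types[OF _ assms(2-6)] .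
    show "?P2 \<Longrightarrow> ?P3" using comm_group.axioms(2) by blast
    show "?P3 \<Longrightarrow> ?P7" using choose_cong_if_nontrivial_units[OF _ _ _ assms(1,2)] by blast
    show "?P7 \<Longrightarrow> ?P1" using mersenne_prime_if_choose_cong[OF assms(1,2)] .
    show "?P1 \<Longrightarrow> ?P4" unfolding R_def
      by (rule GA.mersenne_imp_units[OF _ _ gen(4)]) (auto simp: F2_def UNIV_bit)
    show "?P4 \<Longrightarrow> ?P5" unfolding R_def X_def
      by (rule GA.A.nontrivial_units_imp_trinomial_pow[unfolded GA.A.ev_trinomial])
    show "?P5 \<Longrightarrow> ?P6" unfolding R_def X_def
      by (rule GA.A.trinomial_pow_imp_binomial_pow
          [unfolded GA.A.ev_trinomial GA.A.ev_binomial GA.A.ev_binomial_cube])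
    show "?P6 \<Longrightarrow> ?P7" unfolding R_def X_def
      by (rule GA.A.binomial_pow_imp_choose_cong[unfolded GA.A.ev_binomial GA.A.ev_binomial_cube])
    show "?P1 \<Longrightarrow> ?P8" by (rule CR.mersenne_imp_elementary_abelian)
    show "?P8 \<Longrightarrow> ?P9" unfolding M_def CR.trinomial_circ CR.trinomial_ord_iff
      by (rule CR.elementary_abelian_imp_trinomial_pow)
    show "?P9 \<Longrightarrow> ?P10"
      unfolding M_def CR.trinomial_circ CR.trinomial_ord_iff CR.binomial_circ CR.binomial_cube_circ
      by (rule CR.M.trinomial_pow_imp_binomial_pow)
    show "?P10 \<Longrightarrow> ?P7" unfolding M_def CR.binomial_circ CR.binomial_cube_circ
      by (rule CR.M.binomial_pow_imp_choose_cong)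
    show "?P1 \<Longrightarrow> ?P11" using CR.pseudopaths_if_mersenne by blast
    show "?P11 \<Longrightarrow> ?P12"
      using CR.trinomial_graph(1,2) CR.odd_matchings_trinomial_graph by blast
    show "?P12 \<Longrightarrow> ?P9"
      unfolding M_def CR.trinomial_circ CR.trinomial_ord_iff
      by (rule iffD1[OF pseudopaths_parity_iff[OF CR.trinomial_graph(1), of p,
              unfolded CR.trinomial_graph(3)]]) (use p in simp_all)
  qed
qed

end
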